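(* Let $0<\delta<1$ and let $N$ be a norm on $\mathbb{R}^2$ such that the restriction of $N$ to $\mathbb{R}^2\setminus\{0\}$ is of class $C^{2,\delta}$ and the unit circle $\partial B_N(0,1)$ has strictly positive curvature. Let $J\subset\mathbb{R}$ be an open interval, let $\Omega\subset\mathbb{R}^2$ be a closed Euclidean ball centered at the origin, equipped with the metric $(x,y)\mapsto N(x-y)$, and let $\Pi:J\times\Omega\to\mathbb{R}$ be the family of projections $$\Pi(t,x):=P_{v(t)}(x)\cdot Rv(t).$$ Then $\Pi$ satisfies the following conditions (a), (b) and (c), where $\Phi_t(x,y):=\dfrac{\Pi(t,x)-\Pi(t,y)}{N(x-y)}$ for $t\in J$ and distinct $x,y\in\Omega$. (a) ($C^{1,\delta}$-regularity of $\Pi$) For every compact interval $I\subset J$ there is a constant $C_{I,\delta}>0$ such that $\left|\frac{d}{dt}\Pi(t,x)\right|\le C_{I,\delta}$ for all $t\in I$, $x\in\Omega$, and $\left|\frac{d}{dt}\Pi(t_1,x)-\frac{d}{dt}\Pi(t_2,x)\right|\le C_{I,\delta}|t_1-t_2|^\delta$ for all $t_1,t_2\in I$, $x\in\Omega$. (b) (Transversality) There is a constant $C>0$ such that for all distinct $x,y\in\Omega$ and all $t\in J$ with $|\Phi_t(x,y)|\le C$ one has $\left|\frac{d}{dt}\Phi_t(x,y)\right|\ge C$. (c) ($(1,\delta)$-regularity of $\Phi$) With $C$ as in (b), there are constants $C_\delta>0$ and $\tilde C>0$ such that whenever $x\neq y$ in $\Omega$ and $t_1,t_2\in J$ satisfy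 $|\Phi_{t_1}(x,y)|+|\Phi_{t_2}(x,y)|\le C$, then $\left|\frac{d}{dt}\Phi_{t_1}(x,y)\right|\le\tilde C$ and $\left|\frac{d}{dt}\Phi_{t_1}(x,y)-\frac{d}{dt}\Phi_{t_2}(x,y)\right|\le C_\delta|t_1-t_2|^\delta$.
   Context: $\mathbb{S}^1$ is the Euclidean unit circle in $\mathbb{R}^2$; $B_N(0,1)=\{x\in\mathbb{R}^2:N(x)\le 1\}$; $\cdot$ is the Euclidean scalar product; $v(t):=(\cos t,\sin t)$; $R$ is the counter-clockwise rotation of $\mathbb{R}^2$ by the angle $\pi/2$. A map on an open set $U\subset\mathbb{R}^n$ is of class $C^{k,\delta}$ if it is $k$ times continuously differentiable and its partial derivatives of order $k$ are locally $\delta$-H\"older (i.e. $\delta$-H\"older on every compact subset of $U$). Curvature: under the hypothesis, $\partial B_N(0,1)$ is a simple closed $C^2$ curve; its curvature at $\gamma(t)$ is $\|\ddot\gamma(t)\|$, where $\gamma$ is a parametrization by Euclidean arc-length and $\|\cdot\|$ is the Euclidean norm. Strictly positive curvature implies that $B_N(0,1)$ is strictly convex. For $v\in\mathbb{S}^1$, $H_v:=\{w\in\mathbb{R}^2:v\cdot w=0\}$, and $P_v(x)$ denotes the closest-point projection of $x\in\mathbb{R}^2$ onto $H_v$ with respect to $N$: the unique point of $H_v$ with $N(x-P_v(x))=\min\{N(x-q):q\in H_v\}$ (unique since $N$ is strictly convex). *)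

theory Defs
  imports "HOL-Analysis.Analysis"
begin

definition is_norm :: "('a::real_vector \<Rightarrow> real) \<Rightarrow> bool" where
  "is_norm N \<longleftrightarrow>
     (\<forall>x. 0 \<le> N x) \<and> (\<forall>x. N x = 0 \<longleftrightarrow> x = 0) \<and>
     (\<forall>a x. N (a *\<^sub>R x) = \<bar>a\<bar> * N x) \<and> (\<forall>x y. N (x + y) \<le> N x + N y)"

definition unit_ball_of :: "('a \<Rightarrow> real) \<Rightarrow> 'a set" where
  "unit_ball_of N = {x. N x \<le> 1}"


definition partial_deriv ::
  "'a::euclidean_space \<Rightarrow> ('a \<Rightarrow> 'b::real_normed_vector) \<Rightarrow> 'a \<Rightarrow> 'b" where
  "partial_deriv b f x = vector_derivative (\<lambda>h. f (x + h *\<^sub>R b)) (at 0)"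

(* The list bs of basis vectors encodes a multi-index, so the iterated partial derivatives of
   order k of f are the functions foldr partial_deriv bs f with length bs = k.
   The set U is meant to be open. *)
definition Ck_on ::
  "nat \<Rightarrow> ('a::euclidean_space \<Rightarrow> 'b::real_normed_vector) \<Rightarrow> 'a set \<Rightarrow> bool" where
  "Ck_on k f U \<longleftrightarrow>
     (\<forall>bs\<in>lists Basis. length bs < k \<longrightarrow> foldr partial_deriv bs f differentiable_on U) \<and>
     (\<forall>bs\<in>lists Basis. length bs = k \<longrightarrow> continuous_on U (foldr partial_deriv bs f))"

definition locally_Hoelder_on ::
  "real \<Rightarrow> ('a::metric_space \<Rightarrow> 'b::metric_space) \<Rightarrow> 'a set \<Rightarrow> bool" where
  "locally_Hoelder_on \<delta> g U \<longleftrightarrow>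
     (\<forall>K\<subseteq>U. compact K \<longrightarrow> (\<exists>C. \<forall>x\<in>K. \<forall>y\<in>K. dist (g x) (g y) \<le> C * dist x y powr \<delta>))"

definition Ck_Hoelder_on ::
  "nat \<Rightarrow> real \<Rightarrow> ('a::euclidean_space \<Rightarrow> 'b::real_normed_vector) \<Rightarrow> 'a set \<Rightarrow> bool" where
  "Ck_Hoelder_on k \<delta> f U \<longleftrightarrow> Ck_on k f U \<and>
     (\<forall>bs\<in>lists Basis. length bs = k \<longrightarrow> locally_Hoelder_on \<delta> (foldr partial_deriv bs f) U)"


(* gamma runs through the simple closed curve S, of length L, periodically and with unit speed. *)
definition arclength_parametrization ::
  "(real \<Rightarrow> 'a::real_normed_vector) \<Rightarrow> real \<Rightarrow> 'a set \<Rightarrow> bool" where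
  "arclength_parametrization \<gamma> L S \<longleftrightarrow>
     L > 0 \<and> Ck_on 2 \<gamma> UNIV \<and>
     (\<forall>s. \<gamma> (s + L) = \<gamma> s) \<and> inj_on \<gamma> {0..<L} \<and> \<gamma> ` {0..<L} = S \<and>
     (\<forall>s. norm (vector_derivative \<gamma> (at s)) = 1)"

(* The value is the same for all arc-length parametrizations of a simple closed C^2 curve S;
   on sets S that are not such curves it is unspecified. *)
definition curvature :: "'a::real_normed_vector set \<Rightarrow> 'a \<Rightarrow> real" where
  "curvature S p = (THE \<kappa>. \<exists>\<gamma> L s. arclength_parametrization \<gamma> L S \<and> \<gamma> s = p \<and>
     \<kappa> = norm (vector_derivative (\<lambda>u. vector_derivative \<gamma> (at u)) (at s)))"


definition circle_vec :: "real \<Rightarrow> real ^ 2" where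
  "circle_vec t = vector [cos t, sin t]"

definition rot90 :: "real ^ 2 \<Rightarrow> real ^ 2" where
  "rot90 x = vector [- (x $ 2), x $ 1]"

definition normal_line :: "real ^ 2 \<Rightarrow> (real ^ 2) set" where
  "normal_line v = {w. v \<bullet> w = 0}"

definition closest_proj :: "(real ^ 2 \<Rightarrow> real) \<Rightarrow> real ^ 2 \<Rightarrow> real ^ 2 \<Rightarrow> real ^ 2" where
  "closest_proj N v x =
     (THE p. p \<in> normal_line v \<and> (\<forall>q\<in>normal_line v. N (x - p) \<le> N (x - q)))"

definition proj_family :: "(real ^ 2 \<Rightarrow> real) \<Rightarrow> real \<Rightarrow> real ^ 2 \<Rightarrow> real" where
  "proj_family N t x = closest_proj N (circle_vec t) x \<bullet> rot90 (circle_vec t)"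


(* A family P of real-valued maps is indexed by t in J and defined on the points of X; d is the
   metric on X. Each condition includes the existence of the t-derivatives it mentions. *)

definition diff_quotient ::
  "(real \<Rightarrow> 'a \<Rightarrow> real) \<Rightarrow> ('a \<Rightarrow> 'a \<Rightarrow> real) \<Rightarrow> 'a \<Rightarrow> 'a \<Rightarrow> real \<Rightarrow> real" where
  "diff_quotient P d x y t = (P t x - P t y) / d x y"

definition C1_Hoelder_family ::
  "real \<Rightarrow> real set \<Rightarrow> 'a set \<Rightarrow> (real \<Rightarrow> 'a \<Rightarrow> real) \<Rightarrow> bool" where
  "C1_Hoelder_family \<delta> J X P \<longleftrightarrow>
     (\<forall>t\<in>J. \<forall>x\<in>X. (\<lambda>s. P s x) differentiable (at t)) \<and>
     (\<forall>a b. a \<le> b \<and> {a..b} \<subseteq> J \<longrightarrow>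
       (\<exists>C>0. (\<forall>t\<in>{a..b}. \<forall>x\<in>X. \<bar>deriv (\<lambda>s. P s x) t\<bar> \<le> C) \<and>
              (\<forall>t1\<in>{a..b}. \<forall>t2\<in>{a..b}. \<forall>x\<in>X.
                 \<bar>deriv (\<lambda>s. P s x) t1 - deriv (\<lambda>s. P s x) t2\<bar> \<le> C * \<bar>t1 - t2\<bar> powr \<delta>)))"

definition transversal_family ::
  "real \<Rightarrow> real set \<Rightarrow> 'a set \<Rightarrow> ('a \<Rightarrow> 'a \<Rightarrow> real) \<Rightarrow> (real \<Rightarrow> 'a \<Rightarrow> real) \<Rightarrow> bool" where
  "transversal_family C J X d P \<longleftrightarrow>
     (\<forall>x\<in>X. \<forall>y\<in>X. \<forall>t\<in>J. x \<noteq> y \<and> \<bar>diff_quotient P d x y t\<bar> \<le> C \<longrightarrow>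
        diff_quotient P d x y differentiable (at t) \<and>
        \<bar>deriv (diff_quotient P d x y) t\<bar> \<ge> C)"

definition regular_family ::
  "real \<Rightarrow> real \<Rightarrow> real set \<Rightarrow> 'a set \<Rightarrow> ('a \<Rightarrow> 'a \<Rightarrow> real) \<Rightarrow> (real \<Rightarrow> 'a \<Rightarrow> real) \<Rightarrow> bool" where
  "regular_family \<delta> C J X d P \<longleftrightarrow>
     (\<exists>C\<delta>>0. \<exists>C'>0. \<forall>x\<in>X. \<forall>y\<in>X. \<forall>t1\<in>J. \<forall>t2\<in>J.
        x \<noteq> y \<and> \<bar>diff_quotient P d x y t1\<bar> + \<bar>diff_quotient P d x y t2\<bar> \<le> C \<longrightarrow>
        diff_quotient P d x y differentiable (at t1) \<and>
        diff_quotient P d x y differentiable (at t2) \<and>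
        \<bar>deriv (diff_quotient P d x y) t1\<bar> \<le> C' \<and>
        \<bar>deriv (diff_quotient P d x y) t1 - deriv (diff_quotient P d x y) t2\<bar>
          \<le> C\<delta> * \<bar>t1 - t2\<bar> powr \<delta>)"

end

theory Submission
  imports Defs
begin

text \<open>
  Write \<open>v t\<close> for \<open>circle_vec t\<close>, \<open>\<phi> t = N (v t)\<close> and \<open>\<psi> = \<phi>' / \<phi>\<close>. The gradient of \<open>N\<close> at \<open>v \<alpha>\<close> has polar
  angle \<open>T \<alpha> = \<alpha> + arctan (\<psi> \<alpha>)\<close>, and the curvature of the unit circle of \<open>N\<close> at \<open>v \<alpha> / \<phi> \<alpha>\<close> is a positive
  multiple of \<open>\<bar>T' \<alpha>\<bar>\<close>. Since \<open>T (\<alpha> + 2 * pi) = T \<alpha> + 2 * pi\<close>, nonvanishing curvature forces \<open>T' > 0\<close>, so \<open>T\<close> is a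
  diffeomorphism of the line with inverse \<open>\<theta>\<close>. The point of \<open>{w. v t \<bullet> w = 1}\<close> with least \<open>N\<close> is the one
  of polar angle \<open>\<theta> t\<close>; it equals \<open>v t + g t *\<^sub>R rot90 (v t)\<close> with \<open>g = - \<psi> \<circ> \<theta>\<close>, and therefore
  \<open>proj_family N t x = x \<bullet> u t\<close> for \<open>u t = rot90 (v t) - g t *\<^sub>R v t\<close>. The derivative of \<open>u\<close> is
  bounded and \<open>\<delta>\<close>-Hoelder on the whole line because \<open>\<phi>''\<close> is, and
  \<open>det (u, u') = 1 + g\<^sup>2 + g' = (1 + g\<^sup>2) / T' \<circ> \<theta>\<close> is bounded below. So \<open>e \<bullet> u t\<close> and \<open>e \<bullet> u' t\<close> cannot
  both be small when \<open>N e = 1\<close>, which is transversality.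
\<close>

section \<open>Bounded Hoelder functions\<close>

text \<open>Boundedness is included because a Hoelder condition on the whole line is by itself not
  stable under products. A single \<open>M\<close> serves both estimates.\<close>

definition bounded_Hoelder :: "real \<Rightarrow> (real \<Rightarrow> real) \<Rightarrow> bool" where
  "bounded_Hoelder \<delta> f \<longleftrightarrow> (\<exists>M. \<forall>x y. \<bar>f x\<bar> \<le> M \<and> \<bar>f x - f y\<bar> \<le> M * \<bar>x - y\<bar> powr \<delta>)"

lemma bounded_HoelderE:
  assumes "bounded_Hoelder \<delta> f"
  obtains M where "M > 0" "\<And>x. \<bar>f x\<bar> \<le> M" "\<And>x y. \<bar>f x - f y\<bar> \<le> M * \<bar>x - y\<bar> powr \<delta>"
proof -
  obtain M where M: "\<And>x. \<bar>f x\<bar> \<le> M" "\<And>x y. \<bar>f x - f y\<bar> \<le> M * \<bar>x - y\<bar> powr \<delta>"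
    using assms unfolding bounded_Hoelder_def by blast
  have "0 \<le> M" using M(1)[of 0] by linarith
  moreover have "\<bar>f x - f y\<bar> \<le> (M + 1) * \<bar>x - y\<bar> powr \<delta>" for x y
    by (rule order_trans[OF M(2)]) (simp add: mult_right_mono)
  ultimately show thesis
    using M(1) by (intro that[of "M + 1"]) (auto simp: add_increasing2)
qed

lemma bounded_HoelderI:
  assumes "\<And>x. \<bar>f x\<bar> \<le> M" "\<And>x y. \<bar>f x - f y\<bar> \<le> K * \<bar>x - y\<bar> powr \<delta>"
  shows "bounded_Hoelder \<delta> f"
  unfolding bounded_Hoelder_def
proof (intro exI allI conjI)
  fix x y
  show "\<bar>f x\<bar> \<le> max M K" using assms(1)[of x] by simp
  show "\<bar>f x - f y\<bar> \<le> max M K * \<bar>x - y\<bar> powr \<delta>"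
    by (rule order_trans[OF assms(2)]) (simp add: mult_right_mono)
qed

lemma bounded_Hoelder_const [simp]: "bounded_Hoelder \<delta> (\<lambda>_. c)"
  by (rule bounded_HoelderI[of _ "\<bar>c\<bar>" 0]) auto

lemma bounded_Hoelder_add:
  assumes "bounded_Hoelder \<delta> f" "bounded_Hoelder \<delta> g"
  shows "bounded_Hoelder \<delta> (\<lambda>x. f x + g x)"
proof -
  obtain A B where A: "\<And>x. \<bar>f x\<bar> \<le> A" "\<And>x y. \<bar>f x - f y\<bar> \<le> A * \<bar>x - y\<bar> powr \<delta>"
    and B: "\<And>x. \<bar>g x\<bar> \<le> B" "\<And>x y. \<bar>g x - g y\<bar> \<le> B * \<bar>x - y\<bar> powr \<delta>"
    using assms unfolding bounded_Hoelder_def by blast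
  show ?thesis
  proof (rule bounded_HoelderI[of _ "A + B" "A + B"])
    show "\<bar>f x + g x\<bar> \<le> A + B" for x using A(1)[of x] B(1)[of x] by linarith
    show "\<bar>f x + g x - (f y + g y)\<bar> \<le> (A + B) * \<bar>x - y\<bar> powr \<delta>" for x y
      using A(2)[of x y] B(2)[of x y] unfolding distrib_right by linarith
  qed
qed

lemma bounded_Hoelder_mult:
  assumes "bounded_Hoelder \<delta> f" "bounded_Hoelder \<delta> g"
  shows "bounded_Hoelder \<delta> (\<lambda>x. f x * g x)"
proof -
  obtain A where A: "A > 0" "\<And>x. \<bar>f x\<bar> \<le> A" "\<And>x y. \<bar>f x - f y\<bar> \<le> A * \<bar>x - y\<bar> powr \<delta>"
    using bounded_HoelderE[OF assms(1)] by blast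
  obtain B where B: "B > 0" "\<And>x. \<bar>g x\<bar> \<le> B" "\<And>x y. \<bar>g x - g y\<bar> \<le> B * \<bar>x - y\<bar> powr \<delta>"
    using bounded_HoelderE[OF assms(2)] by blast
  show ?thesis
  proof (rule bounded_HoelderI[of _ "A * B" "2 * A * B"])
    show "\<bar>f x * g x\<bar> \<le> A * B" for x
      unfolding abs_mult using A B by (intro mult_mono) (auto simp: less_imp_le)
    fix x y
    let ?d = "\<bar>x - y\<bar> powr \<delta>"
    have "\<bar>f x * g x - f y * g y\<bar> = \<bar>f x * (g x - g y) + g y * (f x - f y)\<bar>"
      by (simp add: algebra_simps)
    also have "\<dots> \<le> \<bar>f x\<bar> * \<bar>g x - g y\<bar> + \<bar>g y\<bar> * \<bar>f x - f y\<bar>"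
      by (metis abs_mult abs_triangle_ineq)
    also have "\<dots> \<le> A * (B * ?d) + B * (A * ?d)"
      using A(1) B(1)
      by (intro add_mono mult_mono A(2,3) B(2,3)) simp_all
    finally show "\<bar>f x * g x - f y * g y\<bar> \<le> 2 * A * B * ?d"
      by (simp add: algebra_simps)
  qed
qed

lemma bounded_Hoelder_uminus:
  "bounded_Hoelder \<delta> f \<Longrightarrow> bounded_Hoelder \<delta> (\<lambda>x. - f x)"
  using bounded_Hoelder_mult[OF bounded_Hoelder_const[of \<delta> "-1"]] by simp

lemma bounded_Hoelder_diff:
  "bounded_Hoelder \<delta> f \<Longrightarrow> bounded_Hoelder \<delta> g \<Longrightarrow> bounded_Hoelder \<delta> (\<lambda>x. f x - g x)"
  using bounded_Hoelder_add[OF _ bounded_Hoelder_uminus] by fastforce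

lemma bounded_Hoelder_sum:
  "(\<And>i. i \<in> A \<Longrightarrow> bounded_Hoelder \<delta> (f i)) \<Longrightarrow> bounded_Hoelder \<delta> (\<lambda>x. \<Sum>i\<in>A. f i x)"
  by (induction A rule: infinite_finite_induct) (auto intro: bounded_Hoelder_add)

lemma bounded_Hoelder_power:
  "bounded_Hoelder \<delta> f \<Longrightarrow> bounded_Hoelder \<delta> (\<lambda>x. f x ^ n)"
  by (induction n) (auto intro: bounded_Hoelder_mult)

text \<open>It suffices to treat \<open>1 / g\<close>, where
  \<open>\<bar>1 / a - 1 / b\<bar> = \<bar>a - b\<bar> / (a * b)\<close> and the denominator is at
  least \<open>m * m\<close>.\<close>

lemma bounded_Hoelder_divide:
  assumes "bounded_Hoelder \<delta> f" "bounded_Hoelder \<delta> g" "m > 0" "\<And>x. g x \<ge> m"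
  shows "bounded_Hoelder \<delta> (\<lambda>x. f x / g x)"
proof -
  obtain B where B: "B > 0" "\<And>x. \<bar>g x\<bar> \<le> B" "\<And>x y. \<bar>g x - g y\<bar> \<le> B * \<bar>x - y\<bar> powr \<delta>"
    using bounded_HoelderE[OF assms(2)] by blast
  have pos: "g x > 0" for x using assms(3) assms(4)[of x] by linarith
  have "bounded_Hoelder \<delta> (\<lambda>x. inverse (g x))"
  proof (rule bounded_HoelderI[of _ "inverse m" "B / m\<^sup>2"])
    show "\<bar>inverse (g x)\<bar> \<le> inverse m" for x
      using pos[of x] assms(3) assms(4)[of x] by (simp add: le_imp_inverse_le)
    fix x y
    have "inverse (g x) - inverse (g y) = (g y - g x) / (g x * g y)"
      using pos[of x] pos[of y] by (simp add: field_simps)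
    then have "\<bar>inverse (g x) - inverse (g y)\<bar> = \<bar>g x - g y\<bar> / (g x * g y)"
      using pos[of x] pos[of y] by (simp add: abs_divide abs_mult abs_minus_commute)
    also have "\<dots> \<le> (B * \<bar>x - y\<bar> powr \<delta>) / (m * m)"
      using pos assms(3,4) B by (intro frac_le mult_mono) (auto intro: less_imp_le)
    finally show "\<bar>inverse (g x) - inverse (g y)\<bar> \<le> B / m\<^sup>2 * \<bar>x - y\<bar> powr \<delta>"
      by (simp add: power2_eq_square)
  qed
  then show ?thesis
    unfolding divide_inverse by (rule bounded_Hoelder_mult[OF assms(1)])
qed

text \<open>At distance at most 1 the Lipschitz bound wins, since
  \<open>h \<le> h powr \<delta>\<close> for \<open>0 \<le> h \<le> 1\<close>; at larger distances
  the increment is at most \<open>2 * M\<close> while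
  \<open>h powr \<delta> \<ge> 1\<close>.\<close>

lemma bounded_Hoelder_if_DERIV:
  assumes "0 < \<delta>" "\<delta> \<le> 1" "\<And>x. (f has_real_derivative f' x) (at x)"
    "\<And>x. \<bar>f x\<bar> \<le> M" "\<And>x. \<bar>f' x\<bar> \<le> L"
  shows "bounded_Hoelder \<delta> f"
proof (rule bounded_HoelderI[of _ M "2 * M + L"])
  fix x y
  have M: "0 \<le> M" using assms(4)[of 0] by linarith
  have L: "0 \<le> L" using assms(5)[of 0] by linarith
  have lip: "\<bar>f x - f y\<bar> \<le> L * \<bar>x - y\<bar>"
    using field_differentiable_bound[of UNIV f f' L x y] assms(3,5)
    by (auto simp: has_field_derivative_at_within)
  show "\<bar>f x - f y\<bar> \<le> (2 * M + L) * \<bar>x - y\<bar> powr \<delta>"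
  proof (cases "\<bar>x - y\<bar> \<le> 1")
    case True
    have "\<bar>x - y\<bar> \<le> \<bar>x - y\<bar> powr \<delta>"
      using powr_mono'[of \<delta> 1 "\<bar>x - y\<bar>"] True assms(2) by simp
    then have "L * \<bar>x - y\<bar> \<le> (2 * M + L) * \<bar>x - y\<bar> powr \<delta>"
      using L M by (intro mult_mono) auto
    with lip show ?thesis by linarith
  next
    case False
    then have "1 \<le> \<bar>x - y\<bar> powr \<delta>" using assms(1) by (simp add: ge_one_powr_ge_zero)
    then have "2 * M * 1 \<le> (2 * M + L) * \<bar>x - y\<bar> powr \<delta>"
      using L M by (intro mult_mono) auto
    moreover have "\<bar>f x - f y\<bar> \<le> 2 * M" using assms(4)[of x] assms(4)[of y] by linarith
    ultimately show ?thesis by linarith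
  qed
qed (use assms in auto)

lemma bounded_Hoelder_compose_Lipschitz:
  assumes "bounded_Hoelder \<delta> f" "0 < \<delta>" "\<And>x. (h has_real_derivative h' x) (at x)" "\<And>x. \<bar>h' x\<bar> \<le> L"
  shows "bounded_Hoelder \<delta> (\<lambda>x. f (h x))"
proof -
  obtain A where A: "A > 0" "\<And>x. \<bar>f x\<bar> \<le> A" "\<And>x y. \<bar>f x - f y\<bar> \<le> A * \<bar>x - y\<bar> powr \<delta>"
    using bounded_HoelderE[OF assms(1)] by blast
  have L: "0 \<le> L" using assms(4)[of 0] by linarith
  show ?thesis
  proof (rule bounded_HoelderI[of _ A "A * L powr \<delta>"])
    fix x y
    have "\<bar>h x - h y\<bar> \<le> L * \<bar>x - y\<bar>"
      using field_differentiable_bound[of UNIV h h' L x y] assms(3,4)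
      by (auto simp: has_field_derivative_at_within)
    then have "\<bar>h x - h y\<bar> powr \<delta> \<le> L powr \<delta> * \<bar>x - y\<bar> powr \<delta>"
      using L assms(2) by (metis abs_ge_zero less_imp_le powr_mono2 powr_mult)
    then have "A * \<bar>h x - h y\<bar> powr \<delta> \<le> A * (L powr \<delta> * \<bar>x - y\<bar> powr \<delta>)"
      using A(1) by simp
    with A(3)[of "h x" "h y"]
    show "\<bar>f (h x) - f (h y)\<bar> \<le> A * L powr \<delta> * \<bar>x - y\<bar> powr \<delta>" by (simp add: mult.assoc)
  qed (use A in auto)
qed

lemma bounded_Hoelder_imp_continuous:
  assumes "bounded_Hoelder \<delta> f" "0 < \<delta>"
  shows "isCont f x"
proof -
  obtain A where A: "\<And>x y. \<bar>f x - f y\<bar> \<le> A * \<bar>x - y\<bar> powr \<delta>"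
    using assms(1) unfolding bounded_Hoelder_def by blast
  have "((\<lambda>y. \<bar>y - x\<bar>) \<longlongrightarrow> 0) (at x)"
    using tendsto_rabs_zero[OF LIM_zero[OF tendsto_ident_at]] .
  then have "((\<lambda>y. \<bar>y - x\<bar> powr \<delta>) \<longlongrightarrow> 0) (at x)"
    by (rule tendsto_zero_powrI[OF _ tendsto_const _ assms(2)]) simp
  then have "((\<lambda>y. A * \<bar>y - x\<bar> powr \<delta>) \<longlongrightarrow> 0) (at x)"
    by (rule tendsto_mult_right_zero)
  then have "((\<lambda>y. f y - f x) \<longlongrightarrow> 0) (at x)"
    by (rule Lim_null_comparison[rotated]) (use A in auto)
  then show ?thesis unfolding isCont_def using LIM_zero_iff by blast
qed

section \<open>Periodic functions and diffeomorphisms of the line\<close>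

text \<open>Positivity of \<open>f\<close> makes \<open>F\<close> strictly increasing. Surjectivity
  comes from the quasi-periodicity: each period adds the same positive amount
  \<open>q\<close>.\<close>

lemma periodic_diffeomorphism:
  fixes F f :: "real \<Rightarrow> real"
  assumes D: "\<And>x. (F has_real_derivative f x) (at x)" and pos: "\<And>x. f x > 0"
    and per: "\<And>x. F (x + p) = F x + q" and "p > 0"
  obtains G where "\<And>x. G (F x) = x" "\<And>y. F (G y) = y" "strict_mono F" "strict_mono G" "q > 0"
    "\<And>y. (G has_real_derivative 1 / f (G y)) (at y)" "\<And>y. G (y + q) = G y + p"
proof -
  have mono: "strict_mono F"
    by (rule strict_monoI, rule DERIV_pos_imp_increasing) (use D pos in auto)
  have "F 0 < F (0 + p)" using mono \<open>p > 0\<close> by (simp add: strict_mono_less)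
  then have q: "q > 0" using per[of 0] by simp
  have cont: "isCont F x" for x using D DERIV_isCont by blast
  \<comment> \<open>The increments over \<open>n\<close> periods to the right and to the left make
    \<open>F\<close> unbounded in both directions, so the intermediate value theorem reaches every
    \<open>y\<close>.\<close>
  have iter: "F (real n * p) = F 0 + real n * q" for n
  proof (induction n)
    case (Suc n)
    have "F (real (Suc n) * p) = F (real n * p + p)" by (simp add: algebra_simps)
    then show ?case unfolding per Suc.IH by (simp add: algebra_simps)
  qed simp
  have iter': "F (- real n * p) = F 0 - real n * q" for n
  proof (induction n)
    case (Suc n)
    have "F (- real n * p) = F (- real (Suc n) * p + p)" by (simp add: algebra_simps)
    then show ?case unfolding per using Suc.IH by (simp add: algebra_simps)
  qed simp
  have surj: "\<exists>x. F x = y" for y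
  proof -
    obtain n where n: "\<bar>y - F 0\<bar> < real n * q" using reals_Archimedean3[OF q] by blast
    have "F (- real n * p) \<le> y" "y \<le> F (real n * p)"
      unfolding iter iter' using n by linarith+
    moreover have "- real n * p \<le> real n * p" using \<open>p > 0\<close> by simp
    ultimately show ?thesis using IVT[of F "- real n * p" y "real n * p"] cont by blast
  qed
  define G where "G = inv F"
  have inj: "inj F" using mono strict_mono_imp_inj_on by blast
  have GF: "G (F x) = x" for x unfolding G_def using inj by simp
  have FG: "F (G y) = y" for y unfolding G_def using surj by (metis f_inv_into_f rangeI)
  have monoG: "strict_mono G"
    by (rule strict_monoI) (metis FG mono strict_mono_less)
  have contG: "isCont G y" for y
  proof -
    have "isCont G (F (G y))"
      by (rule isCont_inverse_function[of 1 "G y" G F]) (auto simp: GF cont)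
    then show ?thesis by (simp add: FG)
  qed
  have "(G has_real_derivative inverse (f (G y))) (at y)" for y
    by (rule DERIV_inverse_function[of F "f (G y)" G y "y - 1" "y + 1"])
       (use D pos[of "G y"] FG contG in auto)
  moreover have "G (y + q) = G y + p" for y
    by (metis FG GF per)
  ultimately show thesis
    by (intro that[OF GF FG mono monoG q]) (auto simp: inverse_eq_divide)
qed

lemma periodic_range:
  fixes f :: "real \<Rightarrow> 'a"
  assumes "\<And>x. f (x + p) = f x" "p > 0"
  obtains y where "0 \<le> y" "y < p" "f y = f x"
proof -
  have nat: "f (x + real n * p) = f x" for n x
  proof (induction n)
    case (Suc n)
    have "f (x + real (Suc n) * p) = f (x + real n * p + p)" by (simp add: algebra_simps)
    then show ?case using assms(1) Suc.IH by simp
  qed simp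
  have int: "f (x + of_int k * p) = f x" for k x
  proof (cases "k \<ge> 0")
    case True
    then show ?thesis using nat[of x "nat k"] by simp
  next
    case False
    then have "f (x + of_int k * p + real (nat (- k)) * p) = f x" by (simp add: algebra_simps)
    then show ?thesis using nat by metis
  qed
  define y where "y = x + of_int (- \<lfloor>x / p\<rfloor>) * p"
  have e: "y = p * frac (x / p)" using assms(2) by (simp add: y_def frac_def field_simps)
  have "f y = f x" unfolding y_def by (rule int)
  moreover have "0 \<le> y" "y < p"
    unfolding e using assms(2) frac_lt_1[of "x / p"] by (auto simp: frac_ge_0)
  ultimately show thesis using that by blast
qed

text \<open>The extrema over one closed period are global. They are stated as attained values, so
  that a positive function gets a positive lower bound.\<close>

lemma periodic_continuous_bounds:
  fixes f :: "real \<Rightarrow> real"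
  assumes per: "\<And>x. f (x + p) = f x" and "p > 0" and cont: "\<And>x. isCont f x"
  obtains a b where "\<And>x. f a \<le> f x" "\<And>x. f x \<le> f b"
proof -
  have c: "continuous_on {0..p} f" using cont continuous_at_imp_continuous_on by blast
  obtain a where a: "\<And>x. x \<in> {0..p} \<Longrightarrow> f a \<le> f x"
    using continuous_attains_inf[OF compact_Icc _ c] \<open>p > 0\<close> by fastforce
  obtain b where b: "\<And>x. x \<in> {0..p} \<Longrightarrow> f x \<le> f b"
    using continuous_attains_sup[OF compact_Icc _ c] \<open>p > 0\<close> by fastforce
  show thesis
  proof
    fix x
    obtain y where y: "0 \<le> y" "y < p" "f y = f x" using periodic_range[of f p x] per \<open>p > 0\<close> by blast
    show "f a \<le> f x" using a[of y] y by simp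
    show "f x \<le> f b" using b[of y] y by simp
  qed
qed

lemma continuous_antiderivative:
  fixes f :: "real \<Rightarrow> real"
  assumes "\<And>x. isCont f x"
  obtains F where "\<And>x. (F has_real_derivative f x) (at x)"
proof -
  define F where "F x = (LBINT y=ereal 0..ereal x. f y)" for x
  have "(F has_real_derivative f x) (at x)" for x
  proof -
    \<comment> \<open>The interval contains the base point 0 and has \<open>x\<close> in its
      interior, so the derivative within it is the full derivative.\<close>
    have "(F has_vector_derivative f x) (at x within {min (x - 1) (-1)..max (x + 1) 1})"
      unfolding F_def
      by (rule interval_integral_FTC2[where a = "min (x-1) (-1)" and b = "max (x+1) 1"])
         (use assms continuous_at_imp_continuous_on in auto)
    moreover have "x \<in> interior {min (x - 1) (-1)..max (x + 1) 1}" by auto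
    ultimately show ?thesis
      by (metis at_within_interior has_real_derivative_iff_has_vector_derivative)
  qed
  then show thesis using that by blast
qed

section \<open>Partial derivatives along curves\<close>

text \<open>\<open>partial_deriv\<close> is a total function with a default value where no
  derivative exists. Differentiability makes it equal to the differential \<open>D\<close> on basis
  vectors, and linearity then recovers \<open>D\<close>.\<close>

lemma has_derivative_partial_deriv:
  fixes f :: "'a::euclidean_space \<Rightarrow> 'b::real_normed_vector"
  assumes "f differentiable (at x)"
  shows "(f has_derivative (\<lambda>h. \<Sum>b\<in>Basis. (h \<bullet> b) *\<^sub>R partial_deriv b f x)) (at x)"
proof -
  obtain D where D: "(f has_derivative D) (at x)" using assms unfolding differentiable_def by blast
  interpret bounded_linear D using D by (rule has_derivative_bounded_linear)
  have pd: "partial_deriv b f x = D b" for b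
  proof -
    have "((\<lambda>h. x + h *\<^sub>R b) has_derivative (\<lambda>h. h *\<^sub>R b)) (at 0)"
      by (auto intro!: derivative_eq_intros)
    then have "((\<lambda>h. f (x + h *\<^sub>R b)) has_derivative (\<lambda>h. D (h *\<^sub>R b))) (at 0)"
      by (rule has_derivative_compose) (use D in simp)
    then show ?thesis
      unfolding partial_deriv_def
      by (intro vector_derivative_at) (simp add: has_vector_derivative_def scaleR)
  qed
  have "D h = (\<Sum>b\<in>Basis. (h \<bullet> b) *\<^sub>R partial_deriv b f x)" for h
  proof -
    have "D h = D (\<Sum>b\<in>Basis. (h \<bullet> b) *\<^sub>R b)" by (simp add: euclidean_representation)
    then show ?thesis unfolding pd by (simp add: sum scaleR)
  qed
  then have "D = (\<lambda>h. \<Sum>b\<in>Basis. (h \<bullet> b) *\<^sub>R partial_deriv b f x)" by blast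
  with D show ?thesis by simp
qed

lemma has_vector_derivative_along_curve:
  fixes f :: "'a::euclidean_space \<Rightarrow> 'b::real_normed_vector"
  assumes "f differentiable (at (\<gamma> s))" "(\<gamma> has_vector_derivative d) (at s)"
  shows "((\<lambda>s. f (\<gamma> s)) has_vector_derivative (\<Sum>b\<in>Basis. (d \<bullet> b) *\<^sub>R partial_deriv b f (\<gamma> s))) (at s)"
  using has_derivative_compose[OF assms(2)[unfolded has_vector_derivative_def]
      has_derivative_partial_deriv[OF assms(1)]]
  by (simp add: has_vector_derivative_def scaleR_sum_right)

text \<open>The only basis vector of the line is 1, so this turns \<open>Ck_on\<close> for curves
  into statements about ordinary derivatives.\<close>

lemma partial_deriv_1_real: "partial_deriv 1 f = (\<lambda>x::real. vector_derivative f (at x))"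
proof
  fix x :: real
  have "((\<lambda>h. f (x + h)) has_vector_derivative d) (at 0) \<longleftrightarrow> (f has_vector_derivative d) (at x)" for d
  proof
    assume "(f has_vector_derivative d) (at x)"
    moreover have "((+) x has_vector_derivative 1) (at 0)"
      by (auto intro!: derivative_eq_intros)
    ultimately show "((\<lambda>h. f (x + h)) has_vector_derivative d) (at 0)"
      using vector_diff_chain_at[of "(+) x" 1 0 f d] by (simp add: o_def)
  next
    assume "((\<lambda>h. f (x + h)) has_vector_derivative d) (at 0)"
    moreover have "((\<lambda>y. y - x) has_vector_derivative 1) (at x)"
      by (auto intro!: derivative_eq_intros)
    ultimately show "(f has_vector_derivative d) (at x)"
      using vector_diff_chain_at[of "\<lambda>y. y - x" 1 x "\<lambda>h. f (x + h)" d] by (simp add: o_def)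
  qed
  then show "partial_deriv 1 f x = vector_derivative f (at x)"
    unfolding partial_deriv_def vector_derivative_def by simp
qed

lemma Ck_on_2_realD:
  fixes \<gamma> :: "real \<Rightarrow> 'a::real_normed_vector"
  assumes "Ck_on 2 \<gamma> UNIV"
  shows "(\<gamma> has_vector_derivative vector_derivative \<gamma> (at s)) (at s)"
    and "((\<lambda>u. vector_derivative \<gamma> (at u)) has_vector_derivative
           vector_derivative (\<lambda>u. vector_derivative \<gamma> (at u)) (at s)) (at s)"
proof -
  have d: "\<forall>bs\<in>lists Basis. length bs < 2 \<longrightarrow> foldr partial_deriv bs \<gamma> differentiable_on UNIV"
    using assms unfolding Ck_on_def by blast
  have "\<gamma> differentiable_on UNIV" using d[rule_format, of "[]"] by simp
  then show "(\<gamma> has_vector_derivative vector_derivative \<gamma> (at s)) (at s)"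
    by (auto simp: differentiable_on_def vector_derivative_works)
  have "(\<lambda>u. vector_derivative \<gamma> (at u)) differentiable_on UNIV"
    using d[rule_format, of "[1]"] by (simp add: partial_deriv_1_real)
  then show "((\<lambda>u. vector_derivative \<gamma> (at u)) has_vector_derivative
           vector_derivative (\<lambda>u. vector_derivative \<gamma> (at u)) (at s)) (at s)"
    by (auto simp: differentiable_on_def vector_derivative_works)
qed

lemma Ck_on_2_realI:
  fixes \<gamma> :: "real \<Rightarrow> 'a::real_normed_vector"
  assumes d1: "\<And>s. (\<gamma> has_vector_derivative \<gamma>1 s) (at s)"
    and d2: "\<And>s. (\<gamma>1 has_vector_derivative \<gamma>2 s) (at s)"
    and cont: "continuous_on UNIV \<gamma>2"
  shows "Ck_on 2 \<gamma> UNIV"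
proof -
  have p1: "partial_deriv 1 \<gamma> = \<gamma>1" "partial_deriv 1 \<gamma>1 = \<gamma>2"
    using d1 d2 by (auto simp: partial_deriv_1_real intro: vector_derivative_at)
  have diff: "\<gamma> differentiable_on UNIV" "\<gamma>1 differentiable_on UNIV"
    using d1 d2 by (auto simp: differentiable_on_def intro: differentiableI_vector)
  show ?thesis
    unfolding Ck_on_def
  proof (intro conjI ballI impI)
    fix bs :: "real list"
    assume bs: "bs \<in> lists Basis"
    show "foldr partial_deriv bs \<gamma> differentiable_on UNIV" if "length bs < 2"
    proof -
      have "bs = [] \<or> bs = [1]" using that bs by (cases bs) (auto simp: less_Suc_eq)
      then show ?thesis using p1 diff by auto
    qed
    show "continuous_on UNIV (foldr partial_deriv bs \<gamma>)" if "length bs = 2"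
    proof -
      have "bs = [1, 1]" using that bs by (auto simp: length_Suc_conv numeral_2_eq_2)
      then show ?thesis using p1 cont by simp
    qed
  qed
qed

section \<open>Plane vectors\<close>

lemma circle_vec_nth [simp]: "circle_vec t $ 1 = cos t" "circle_vec t $ 2 = sin t"
  by (simp_all add: circle_vec_def)

lemma rot90_nth [simp]: "rot90 x $ 1 = - (x $ 2)" "rot90 x $ 2 = x $ 1"
  by (simp_all add: rot90_def)

lemma vec2_eq_iff: "x = y \<longleftrightarrow> x $ 1 = y $ 1 \<and> x $ 2 = (y :: 'a ^ 2) $ 2"
  by (simp add: vec_eq_iff forall_2)

lemma inner_vec2: "x \<bullet> y = x $ 1 * y $ 1 + x $ 2 * (y :: real ^ 2) $ 2"
  by (simp add: inner_vec_def sum_2)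

lemma norm_vec2_eq_1: "norm (x :: real ^ 2) = 1 \<longleftrightarrow> (x $ 1)\<^sup>2 + (x $ 2)\<^sup>2 = 1"
  by (simp add: norm_eq_1 inner_vec2 power2_eq_square)

lemma norm_circle_vec [simp]: "norm (circle_vec t) = 1"
  by (simp add: norm_vec2_eq_1)

lemma circle_vec_nonzero [simp]: "circle_vec t \<noteq> 0"
  by (metis norm_circle_vec norm_zero zero_neq_one)

lemma rot90_circle_vec: "rot90 (circle_vec t) = circle_vec (t + pi / 2)"
  by (simp add: vec2_eq_iff cos_add sin_add)

lemma norm_rot90_circle_vec [simp]: "norm (rot90 (circle_vec t)) = 1"
  by (simp add: rot90_circle_vec)

lemma circle_vec_2pi [simp]: "circle_vec (t + 2 * pi) = circle_vec t"
  by (simp add: vec2_eq_iff)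

lemma has_vector_derivative_vec2:
  fixes f :: "real \<Rightarrow> real ^ 2"
  assumes "((\<lambda>t. f t $ 1) has_real_derivative d $ 1) (at t within S)"
    "((\<lambda>t. f t $ 2) has_real_derivative d $ 2) (at t within S)"
  shows "(f has_vector_derivative d) (at t within S)"
proof -
  have "((\<lambda>t. f t $ i) has_derivative (\<lambda>h. h * d $ i)) (at t within S)" for i
    using assms exhaust_2[of i] by (auto simp: has_field_derivative_def mult_commute_abs)
  then show ?thesis
    unfolding has_vector_derivative_def has_derivative_componentwise_within[of f]
    by (auto simp: Basis_vec_def inner_axis)
qed

lemma has_vector_derivative_circle_vec:
  "(circle_vec has_vector_derivative rot90 (circle_vec t)) (at t)"
  by (rule has_vector_derivative_vec2) (auto intro!: derivative_eq_intros)

lemma has_vector_derivative_rot90_circle_vec: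
  "((\<lambda>t. rot90 (circle_vec t)) has_vector_derivative - circle_vec t) (at t)"
  by (rule has_vector_derivative_vec2) (auto intro!: derivative_eq_intros)

lemma vec2_polar:
  fixes x :: "real ^ 2"
  assumes "x \<noteq> 0"
  obtains \<theta> where "0 \<le> \<theta>" "\<theta> < 2 * pi" "x = norm x *\<^sub>R circle_vec \<theta>"
proof -
  have "(x $ 1 / norm x)\<^sup>2 + (x $ 2 / norm x)\<^sup>2 = x \<bullet> x / (norm x)\<^sup>2"
    by (simp add: inner_vec2 power2_eq_square add_divide_distrib)
  also have "\<dots> = 1" using assms by (simp add: power2_norm_eq_inner)
  finally obtain \<theta> where t: "0 \<le> \<theta>" "\<theta> < 2 * pi" "x $ 1 / norm x = cos \<theta>" "x $ 2 / norm x = sin \<theta>"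
    using sincos_total_2pi by metis
  then have "x = norm x *\<^sub>R circle_vec \<theta>"
    using assms unfolding vec2_eq_iff by (auto simp flip: t(3,4))
  with t show thesis using that by blast
qed

lemma circle_vec_inj:
  assumes "circle_vec a = circle_vec b" "0 \<le> a" "a < 2 * pi" "0 \<le> b" "b < 2 * pi"
  shows "a = b"
proof -
  have c: "cos a = cos b" "sin a = sin b" using assms(1) by (simp_all add: vec2_eq_iff)
  then have "cos (a - b) = 1" by (metis cos_diff sin_cos_squared_add3)
  then obtain n :: int where n: "a - b = of_int n * 2 * pi"
    using cos_one_2pi_int by blast
  have "\<bar>of_int n * (2 * pi)\<bar> < 2 * pi"
    using n assms(2-5) unfolding mult.assoc by linarith
  then have "\<bar>of_int n :: real\<bar> < 1" by (simp add: abs_mult)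
  then have "n = 0" by linarith
  then show ?thesis using n by simp
qed

text \<open>Both vectors lie on the line orthogonal to \<open>n\<close>, so their determinant
  vanishes, and Lagrange's identity for unit vectors gives
  \<open>(a \<bullet> b)\<^sup>2 = 1\<close>.\<close>

lemma vec2_orthogonal_unit:
  fixes n a b :: "real ^ 2"
  assumes "n \<noteq> 0" "n \<bullet> a = 0" "n \<bullet> b = 0" "norm a = 1" "norm b = 1"
  shows "a = b \<or> a = - b"
proof -
  have det: "a $ 1 * b $ 2 = a $ 2 * b $ 1"
  proof -
    have "n $ 1 * (a $ 1 * b $ 2 - a $ 2 * b $ 1) = 0" "n $ 2 * (a $ 1 * b $ 2 - a $ 2 * b $ 1) = 0"
      using assms(2,3) unfolding inner_vec2 by algebra+
    then show ?thesis using assms(1) by (auto simp: vec2_eq_iff)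
  qed
  have u: "(a $ 1)\<^sup>2 + (a $ 2)\<^sup>2 = 1" "(b $ 1)\<^sup>2 + (b $ 2)\<^sup>2 = 1"
    using assms(4,5) by (auto simp: norm_vec2_eq_1)
  have "(a $ 1 * b $ 1 + a $ 2 * b $ 2)\<^sup>2 = 1" using det u by algebra
  then have "a \<bullet> b = 1 \<or> a \<bullet> b = -1" by (simp add: inner_vec2 power2_eq_1_iff)
  then show ?thesis
  proof
    assume "a \<bullet> b = 1"
    then have "a $ 1 = b $ 1" "a $ 2 = b $ 2" using u det unfolding inner_vec2 by algebra+
    then show ?thesis by (simp add: vec2_eq_iff)
  next
    assume "a \<bullet> b = -1"
    then have "a $ 1 = - b $ 1" "a $ 2 = - b $ 2" using u det unfolding inner_vec2 by algebra+
    then show ?thesis by (simp add: vec2_eq_iff)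
  qed
qed

text \<open>Serves to show two vectors equal by comparing their products with \<open>n\<close> and
  \<open>a\<close>. A nonzero \<open>c\<close> would, once normalised, be \<open>a\<close> or
  \<open>- a\<close>, contradicting \<open>a \<bullet> c = 0\<close>.\<close>

lemma vec2_orthogonal_basis_zero:
  fixes n a c :: "real ^ 2"
  assumes "n \<noteq> 0" "n \<bullet> a = 0" "norm a = 1" "n \<bullet> c = 0" "a \<bullet> c = 0"
  shows "c = 0"
proof (rule ccontr)
  assume "c \<noteq> 0"
  then have e: "norm (c /\<^sub>R norm c) = 1" by simp
  have "c /\<^sub>R norm c = a \<or> c /\<^sub>R norm c = - a"
    by (rule vec2_orthogonal_unit[OF assms(1) _ assms(2) e assms(3)]) (simp add: assms)
  moreover have "a \<bullet> (c /\<^sub>R norm c) = 0" using assms(5) by simp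
  ultimately have "a \<bullet> a = 0" by (metis inner_minus_right neg_equal_0_iff_equal)
  then show False using assms(3) by simp
qed

lemma one_plus_square_pos [simp]: "1 + (x :: real)\<^sup>2 > 0" "1 + (x :: real)\<^sup>2 \<noteq> 0"
  by (smt (verit) zero_le_power2)+

lemma norm_vec2_le: "norm (x :: real ^ 2) \<le> \<bar>x $ 1\<bar> + \<bar>x $ 2\<bar>"
  using norm_le_l1_cart[of x] by (simp add: sum_2)

lemma inner_rot90_self [simp]: "x \<bullet> rot90 x = 0" "rot90 x \<bullet> x = 0" "rot90 x \<bullet> rot90 y = x \<bullet> y"
  by (simp_all add: inner_vec2)

lemma circle_vec_inner_self [simp]: "circle_vec t \<bullet> circle_vec t = 1"
  by (metis norm_circle_vec norm_eq_1)

lemma circle_vec_frame: "w = (circle_vec t \<bullet> w) *\<^sub>R circle_vec t + (rot90 (circle_vec t) \<bullet> w) *\<^sub>R rot90 (circle_vec t)"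
proof -
  have "cos t * (cos t * a) + sin t * (sin t * a) = (cos t * cos t + sin t * sin t) * a" for a
    by (simp only: distrib_right mult.assoc)
  then have *: "cos t * (cos t * a) + sin t * (sin t * a) = a" for a
    by (simp only: sin_cos_squared_add3 mult_1)
  show ?thesis
    by (simp add: vec2_eq_iff inner_vec2 algebra_simps) (simp add: *)
qed

text \<open>Polar coordinates on the line \<open>{w. circle_vec t \<bullet> w = 1}\<close>: the
  offset \<open>s\<close> along the line is the tangent of the angle measured from
  \<open>t\<close>.\<close>

lemma circle_vec_plus_rot90:
  "circle_vec t + s *\<^sub>R rot90 (circle_vec t) = sqrt (1 + s\<^sup>2) *\<^sub>R circle_vec (t + arctan s)"
  by (simp add: vec2_eq_iff cos_add sin_add cos_arctan sin_arctan) (simp add: field_simps)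

lemma DERIV_sqrt_one_plus_square:
  "((\<lambda>s. sqrt (1 + s\<^sup>2)) has_real_derivative s / sqrt (1 + s\<^sup>2)) (at s)"
proof -
  have "((\<lambda>s. sqrt (1 + s\<^sup>2)) has_real_derivative inverse (sqrt (1 + s\<^sup>2)) / 2 * (2 * s)) (at s)"
  proof (rule DERIV_chain2[where f = sqrt and g = "\<lambda>s. 1 + s\<^sup>2"])
    show "(sqrt has_real_derivative inverse (sqrt (1 + s\<^sup>2)) / 2) (at (1 + s\<^sup>2))"
      by (intro DERIV_real_sqrt one_plus_square_pos)
  qed (auto intro!: derivative_eq_intros)
  moreover have "inverse q / 2 * (2 * s) = s / q" for q :: real
    by (simp add: inverse_eq_divide)
  ultimately show ?thesis by (simp only:)
qed

section \<open>Norms of class C2\<close>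

locale planar_C2_norm =
  fixes N :: "real ^ 2 \<Rightarrow> real" and \<delta> :: real
  assumes \<delta>_pos: "0 < \<delta>" and \<delta>_less_1: "\<delta> < 1"
    and norm_N: "is_norm N" and C2_Hoelder: "Ck_Hoelder_on 2 \<delta> N (- {0})"
begin

lemma N_nonneg [simp]: "0 \<le> N x" and N_eq_0_iff [simp]: "N x = 0 \<longleftrightarrow> x = 0"
  and N_scaleR: "N (a *\<^sub>R x) = \<bar>a\<bar> * N x" and N_triangle: "N (x + y) \<le> N x + N y"
  using norm_N unfolding is_norm_def by auto

lemma N_zero [simp]: "N 0 = 0" by simp

lemma N_pos: "x \<noteq> 0 \<Longrightarrow> N x > 0"
  by (simp add: order_less_le)

section \<open>First and second differentials of the norm\<close>

definition D1 :: "real ^ 2 \<Rightarrow> real ^ 2 \<Rightarrow> real" where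
  "D1 p h = (\<Sum>b\<in>Basis. (h \<bullet> b) * partial_deriv b N p)"

text \<open>The Hessian form. The order of differentiation is kept: \<open>h\<close> belongs to the
  inner derivative and \<open>k\<close> to the outer one, as the chain rule produces them.\<close>

definition D2 :: "real ^ 2 \<Rightarrow> real ^ 2 \<Rightarrow> real ^ 2 \<Rightarrow> real" where
  "D2 p h k = (\<Sum>b\<in>Basis. (h \<bullet> b) * (\<Sum>c\<in>Basis. (k \<bullet> c) * partial_deriv c (partial_deriv b N) p))"

lemma N_differentiable: "p \<noteq> 0 \<Longrightarrow> N differentiable (at p)"
  and partial_deriv_N_differentiable: "b \<in> Basis \<Longrightarrow> p \<noteq> 0 \<Longrightarrow> partial_deriv b N differentiable (at p)"
proof -
  have d: "\<forall>bs\<in>lists Basis. length bs < 2 \<longrightarrow> foldr partial_deriv bs N differentiable_on (- {0})"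
    using C2_Hoelder unfolding Ck_Hoelder_on_def Ck_on_def by blast
  have o: "open (- {0 :: real ^ 2})" by (intro open_Compl closed_singleton)
  show "N differentiable (at p)" if "p \<noteq> 0"
    using d[rule_format, of "[]"] that by (simp add: differentiable_on_eq_differentiable_at[OF o])
  show "partial_deriv b N differentiable (at p)" if "b \<in> Basis" "p \<noteq> 0"
    using d[rule_format, of "[b]"] that by (simp add: differentiable_on_eq_differentiable_at[OF o])
qed

lemma DERIV_N_curve:
  assumes "(\<gamma> has_vector_derivative d) (at s)" "\<gamma> s \<noteq> 0"
  shows "((\<lambda>s. N (\<gamma> s)) has_real_derivative D1 (\<gamma> s) d) (at s)"
  using has_vector_derivative_along_curve[OF N_differentiable[OF assms(2)] assms(1)]
  by (simp add: has_real_derivative_iff_has_vector_derivative D1_def)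

lemma DERIV_D1_curve:
  assumes "(\<gamma> has_vector_derivative d) (at s)" "(\<beta> has_vector_derivative e) (at s)" "\<gamma> s \<noteq> 0"
  shows "((\<lambda>s. D1 (\<gamma> s) (\<beta> s)) has_real_derivative D1 (\<gamma> s) e + D2 (\<gamma> s) (\<beta> s) d) (at s)"
proof -
  have "((\<lambda>s. (\<beta> s \<bullet> b) * partial_deriv b N (\<gamma> s)) has_real_derivative
      (e \<bullet> b) * partial_deriv b N (\<gamma> s) +
      (\<beta> s \<bullet> b) * (\<Sum>c\<in>Basis. (d \<bullet> c) * partial_deriv c (partial_deriv b N) (\<gamma> s))) (at s)"
    if b: "b \<in> Basis" for b
  proof -
    have 1: "((\<lambda>s. \<beta> s \<bullet> b) has_real_derivative e \<bullet> b) (at s)"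
      using bounded_linear.has_vector_derivative[OF bounded_linear_inner_left assms(2)]
      by (simp add: has_real_derivative_iff_has_vector_derivative)
    have 2: "((\<lambda>s. partial_deriv b N (\<gamma> s)) has_real_derivative
        (\<Sum>c\<in>Basis. (d \<bullet> c) * partial_deriv c (partial_deriv b N) (\<gamma> s))) (at s)"
      using has_vector_derivative_along_curve[OF partial_deriv_N_differentiable[OF b assms(3)] assms(1)]
      by (simp add: has_real_derivative_iff_has_vector_derivative)
    show ?thesis using DERIV_mult[OF 1 2] by (simp add: algebra_simps)
  qed
  then show ?thesis
    unfolding D1_def D2_def sum.distrib[symmetric] by (rule DERIV_sum)
qed

lemma D1_inner: "D1 p h = (\<Sum>b\<in>Basis. partial_deriv b N p *\<^sub>R b) \<bullet> h"
  by (simp add: D1_def inner_sum_left inner_commute[of h] mult.commute)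

lemma D2_minus_minus [simp]: "D2 p (- h) (- h) = D2 p h h"
  by (simp add: D2_def sum_negf)

text \<open>Euler's identity for a function homogeneous of degree 1: the derivative of
  \<open>s \<mapsto> N (s *\<^sub>R p)\<close> at 1 is computed by the chain rule and by
  homogeneity.\<close>

lemma D1_self: assumes "p \<noteq> 0" shows "D1 p p = N p"
proof -
  have "((\<lambda>s. s *\<^sub>R p) has_vector_derivative p) (at 1)"
    by (auto intro!: derivative_eq_intros)
  then have 1: "((\<lambda>s. N (s *\<^sub>R p)) has_real_derivative D1 p p) (at 1)"
    using DERIV_N_curve[of "\<lambda>s. s *\<^sub>R p" p 1] assms by simp
  have "((\<lambda>s. s * N p) has_real_derivative N p) (at 1)"
    by (auto intro!: derivative_eq_intros)
  then have "((\<lambda>s. N (s *\<^sub>R p)) has_real_derivative N p) (at 1)"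
  proof (rule has_field_derivative_transform_within_open[where S = "{0<..}"])
    show "s * N p = N (s *\<^sub>R p)" if "s \<in> {0<..}" for s using that by (simp add: N_scaleR)
  qed auto
  with 1 show ?thesis using DERIV_unique by blast
qed

lemma continuous_N: "continuous_on UNIV N"
proof -
  have *: "isCont N x" if "x \<noteq> 0" for x
    using N_differentiable[OF that] differentiable_imp_continuous_within by blast
  have "isCont N 0"
  proof -
    \<comment> \<open>At the origin smoothness gives nothing, so continuity there comes from the
      triangle inequality applied to the coordinate expansion of \<open>x\<close>.\<close>
    have "N x \<le> (\<Sum>b\<in>Basis. \<bar>x \<bullet> b\<bar> * N b)" for x
    proof -
      have tri: "N (\<Sum>b\<in>A. f b) \<le> (\<Sum>b\<in>A. N (f b))" if "finite A" for A and f :: "real ^ 2 \<Rightarrow> real ^ 2"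
        using that by induction (auto intro: order_trans[OF N_triangle])
      have "N (\<Sum>b\<in>Basis. (x \<bullet> b) *\<^sub>R b) \<le> (\<Sum>b\<in>Basis. N ((x \<bullet> b) *\<^sub>R b))" by (rule tri) simp
      then show ?thesis by (simp add: euclidean_representation N_scaleR)
    qed
    moreover have "((\<lambda>x. \<Sum>b\<in>Basis. \<bar>x \<bullet> b\<bar> * N b) \<longlongrightarrow> (\<Sum>b\<in>Basis. \<bar>0 \<bullet> b\<bar> * N b)) (at 0)"
      by (intro tendsto_intros)
    ultimately have "(N \<longlongrightarrow> 0) (at 0)"
      by (intro Lim_null_comparison[of N "\<lambda>x. \<Sum>b\<in>Basis. \<bar>x \<bullet> b\<bar> * N b"]) (auto simp: always_eventually)
    then show ?thesis unfolding isCont_def by simp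
  qed
  with * show ?thesis by (metis continuous_at_imp_continuous_on)
qed

text \<open>The point is that the interior is \<open>{x. N x < 1}\<close>: an interior point remains
  in the ball after stretching by some \<open>s > 1\<close>, whence
  \<open>N x \<le> 1 / s\<close>.\<close>

lemma frontier_unit_ball: "frontier (unit_ball_of N) = {x. N x = 1}"
proof -
  have cl: "closed {x. N x \<le> 1}"
    using continuous_closed_preimage[OF continuous_N closed_UNIV closed_atMost[of 1]]
    by (simp add: vimage_def)
  have op: "open {x. N x < 1}"
    using continuous_open_preimage[OF continuous_N open_UNIV open_lessThan[of 1]]
    by (simp add: vimage_def)
  have "interior {x. N x \<le> 1} = {x. N x < 1}"
  proof (intro equalityI)
    show "{x. N x < 1} \<subseteq> interior {x. N x \<le> 1}"
      by (rule interior_maximal) (use op in auto)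
    show "interior {x. N x \<le> 1} \<subseteq> {x. N x < 1}"
    proof
      fix x assume x: "x \<in> interior {x. N x \<le> 1}"
      have "((\<lambda>s. s *\<^sub>R x) \<longlongrightarrow> 1 *\<^sub>R x) (at_right (1::real))" by (intro tendsto_intros)
      then have "\<forall>\<^sub>F s in at_right (1::real). s *\<^sub>R x \<in> interior {x. N x \<le> 1}"
        by (rule topological_tendstoD) (use x in auto)
      moreover have "\<forall>\<^sub>F s in at_right (1::real). s > 1" by (simp add: eventually_at_right_less)
      ultimately have "\<forall>\<^sub>F s in at_right (1::real). s > 1 \<and> N (s *\<^sub>R x) \<le> 1"
        by eventually_elim (use interior_subset in auto)
      then obtain s where s: "s > (1::real)" "N (s *\<^sub>R x) \<le> 1"
        using eventually_happens'[OF trivial_limit_at_right_real] by blast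
      then have "s * N x \<le> 1" by (simp add: N_scaleR)
      then show "x \<in> {x. N x < 1}"
        using s(1) mult_left_mono[of 1 "N x" s] by fastforce
    qed
  qed
  then show ?thesis
    unfolding frontier_def unit_ball_of_def closure_closed[OF cl] by auto
qed

section \<open>The norm as a function of the polar angle\<close>

definition \<phi> where "\<phi> t = N (circle_vec t)"
definition \<phi>' where "\<phi>' t = D1 (circle_vec t) (rot90 (circle_vec t))"
definition \<phi>'' where
  "\<phi>'' t = D1 (circle_vec t) (- circle_vec t)
     + D2 (circle_vec t) (rot90 (circle_vec t)) (rot90 (circle_vec t))"

lemma \<phi>_pos [simp]: "\<phi> t > 0" by (simp add: \<phi>_def N_pos)

lemma \<phi>_nonzero [simp]: "\<phi> t \<noteq> 0" using \<phi>_pos[of t] by linarith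

lemma DERIV_\<phi>: "(\<phi> has_real_derivative \<phi>' t) (at t)"
  unfolding \<phi>_def[abs_def] \<phi>'_def by (rule DERIV_N_curve[OF has_vector_derivative_circle_vec]) simp

lemma DERIV_\<phi>': "(\<phi>' has_real_derivative \<phi>'' t) (at t)"
  unfolding \<phi>'_def[abs_def] \<phi>''_def
  by (rule DERIV_D1_curve[OF has_vector_derivative_circle_vec has_vector_derivative_rot90_circle_vec]) simp

lemma \<phi>_periodic [simp]: "\<phi> (t + 2 * pi) = \<phi> t" "\<phi>' (t + 2 * pi) = \<phi>' t" "\<phi>'' (t + 2 * pi) = \<phi>'' t"
  by (simp_all add: \<phi>_def \<phi>'_def \<phi>''_def)

section \<open>Global Hoelder regularity in the polar angle\<close>

lemma bounded_Hoelder_circle_vec: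
  "bounded_Hoelder \<delta> (\<lambda>t. circle_vec t \<bullet> b)" "bounded_Hoelder \<delta> (\<lambda>t. rot90 (circle_vec t) \<bullet> b)"
proof -
  have *: "\<bar>circle_vec t \<bullet> b\<bar> \<le> norm b" "\<bar>rot90 (circle_vec t) \<bullet> b\<bar> \<le> norm b" for t
    using Cauchy_Schwarz_ineq2[of "circle_vec t" b] Cauchy_Schwarz_ineq2[of "rot90 (circle_vec t)" b] by simp_all
  have d: "((\<lambda>t. circle_vec t \<bullet> b) has_real_derivative rot90 (circle_vec t) \<bullet> b) (at t)"
    "((\<lambda>t. rot90 (circle_vec t) \<bullet> b) has_real_derivative - circle_vec t \<bullet> b) (at t)" for t
    using bounded_linear.has_vector_derivative[OF bounded_linear_inner_left has_vector_derivative_circle_vec]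
      bounded_linear.has_vector_derivative[OF bounded_linear_inner_left has_vector_derivative_rot90_circle_vec]
    by (simp_all add: has_real_derivative_iff_has_vector_derivative)
  show "bounded_Hoelder \<delta> (\<lambda>t. circle_vec t \<bullet> b)"
    by (rule bounded_Hoelder_if_DERIV[OF \<delta>_pos _ d(1)]) (use * \<delta>_less_1 in auto)
  show "bounded_Hoelder \<delta> (\<lambda>t. rot90 (circle_vec t) \<bullet> b)"
    by (rule bounded_Hoelder_if_DERIV[OF \<delta>_pos _ d(2)]) (use * \<delta>_less_1 in auto)
qed

text \<open>The Euclidean unit circle is compact and avoids the origin, so the local Hoelder
  condition holds on it with one constant. Since \<open>circle_vec\<close> is 1-Lipschitz, the
  estimate passes to the angle.\<close>

lemma bounded_Hoelder_partial_deriv_2: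
  assumes "b \<in> Basis" "c \<in> Basis"
  shows "bounded_Hoelder \<delta> (\<lambda>t. partial_deriv c (partial_deriv b N) (circle_vec t))"
proof -
  let ?g = "partial_deriv c (partial_deriv b N)"
  have "locally_Hoelder_on \<delta> (foldr partial_deriv [c, b] N) (- {0})"
    using C2_Hoelder assms unfolding Ck_Hoelder_on_def
    by (auto simp del: foldr.simps)
  then have loc: "locally_Hoelder_on \<delta> ?g (- {0})" by simp
  have "sphere 0 1 \<subseteq> - {0 :: real ^ 2}" "compact (sphere (0 :: real ^ 2) 1)" by auto
  then obtain C where C: "\<forall>x\<in>sphere 0 1. \<forall>y\<in>sphere 0 1. dist (?g x) (?g y) \<le> C * dist x y powr \<delta>"
    using loc[unfolded locally_Hoelder_on_def, rule_format, of "sphere 0 1"] by blast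
  \<comment> \<open>The constant \<open>C\<close> is not known to be nonnegative; its absolute value
    is needed for the monotonicity arguments below.\<close>
  have C': "\<bar>?g (circle_vec x) - ?g (circle_vec y)\<bar> \<le> \<bar>C\<bar> * dist (circle_vec x) (circle_vec y) powr \<delta>" for x y
  proof -
    have "\<bar>?g (circle_vec x) - ?g (circle_vec y)\<bar> \<le> C * dist (circle_vec x) (circle_vec y) powr \<delta>"
      using C by (simp add: dist_real_def)
    also have "\<dots> \<le> \<bar>C\<bar> * dist (circle_vec x) (circle_vec y) powr \<delta>" by (simp add: mult_right_mono)
    finally show ?thesis .
  qed
  show ?thesis
  proof (rule bounded_HoelderI)
    fix x y
    have "norm (circle_vec x - circle_vec y) \<le> 1 * norm (x - y)"
      by (rule differentiable_bound[of UNIV circle_vec "\<lambda>t h. h *\<^sub>R rot90 (circle_vec t)"])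
         (use has_vector_derivative_circle_vec in
           \<open>auto simp: has_vector_derivative_def onorm_scaleR_left onorm_id intro: has_derivative_at_withinI\<close>)
    then have "dist (circle_vec x) (circle_vec y) powr \<delta> \<le> \<bar>x - y\<bar> powr \<delta>"
      using \<delta>_pos by (intro powr_mono2) (auto simp: dist_norm)
    then show "\<bar>?g (circle_vec x) - ?g (circle_vec y)\<bar> \<le> \<bar>C\<bar> * \<bar>x - y\<bar> powr \<delta>"
      by (intro order_trans[OF C']) (simp add: mult_left_mono)
  next
    fix x
    \<comment> \<open>Boundedness follows from comparison with the value at angle 0, the circle
      having diameter 2.\<close>
    have "dist (circle_vec x) (circle_vec 0) \<le> 2"
      using norm_triangle_ineq4[of "circle_vec x" "circle_vec 0"] by (simp add: dist_norm)
    then have "dist (circle_vec x) (circle_vec 0) powr \<delta> \<le> 2 powr \<delta>"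
      using \<delta>_pos by (intro powr_mono2) auto
    then have "\<bar>C\<bar> * dist (circle_vec x) (circle_vec 0) powr \<delta> \<le> \<bar>C\<bar> * 2 powr \<delta>"
      by (simp add: mult_left_mono)
    with C'[of x 0] show "\<bar>?g (circle_vec x)\<bar> \<le> \<bar>?g (circle_vec 0)\<bar> + \<bar>C\<bar> * 2 powr \<delta>" by linarith
  qed
qed

text \<open>Descends from a derivative to its antiderivative; periodicity supplies the boundedness
  of \<open>f\<close>.\<close>

lemma bounded_Hoelder_continuous_DERIV:
  assumes D: "\<And>t. (f has_real_derivative f' t) (at t)" and f': "bounded_Hoelder \<delta> f'"
    and per: "\<And>t. f (t + 2 * pi) = f t"
  shows "bounded_Hoelder \<delta> f"
proof -
  obtain a b where ab: "\<And>x. f a \<le> f x" "\<And>x. f x \<le> f b"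
    using periodic_continuous_bounds[of f "2 * pi"] per DERIV_isCont[OF D] by auto
  obtain M where "\<And>x. \<bar>f' x\<bar> \<le> M" using bounded_HoelderE[OF f'] by metis
  moreover have "\<bar>f x\<bar> \<le> \<bar>f a\<bar> + \<bar>f b\<bar>" for x using ab(1)[of x] ab(2)[of x] by linarith
  ultimately show ?thesis
    using bounded_Hoelder_if_DERIV[OF \<delta>_pos _ D] \<delta>_less_1 by (meson less_imp_le)
qed

text \<open>The first partial derivatives along the circle are periodic with a derivative built from
  second ones, hence Hoelder; then \<open>\<phi>''\<close> is made of sums and products of Hoelder
  functions.\<close>

lemma bounded_Hoelder_\<phi>'': "bounded_Hoelder \<delta> \<phi>''"
proof -
  have pd: "bounded_Hoelder \<delta> (\<lambda>t. partial_deriv b N (circle_vec t))" if b: "b \<in> Basis" for b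
  proof (rule bounded_Hoelder_continuous_DERIV)
    show "((\<lambda>t. partial_deriv b N (circle_vec t)) has_real_derivative
        (\<Sum>c\<in>Basis. (rot90 (circle_vec t) \<bullet> c) * partial_deriv c (partial_deriv b N) (circle_vec t))) (at t)" for t
      using has_vector_derivative_along_curve[OF partial_deriv_N_differentiable[OF b circle_vec_nonzero]
          has_vector_derivative_circle_vec]
      by (simp add: has_real_derivative_iff_has_vector_derivative)
  qed (auto intro!: bounded_Hoelder_sum bounded_Hoelder_mult bounded_Hoelder_circle_vec
        bounded_Hoelder_partial_deriv_2 b)
  show ?thesis
    unfolding \<phi>''_def[abs_def] D1_def D2_def inner_minus_left
    by (intro bounded_Hoelder_add bounded_Hoelder_sum bounded_Hoelder_mult bounded_Hoelder_uminus
        bounded_Hoelder_circle_vec bounded_Hoelder_partial_deriv_2 pd)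
qed

lemma bounded_Hoelder_\<phi>': "bounded_Hoelder \<delta> \<phi>'"
  by (rule bounded_Hoelder_continuous_DERIV[OF DERIV_\<phi>' bounded_Hoelder_\<phi>'']) simp

lemma bounded_Hoelder_\<phi>: "bounded_Hoelder \<delta> \<phi>"
  by (rule bounded_Hoelder_continuous_DERIV[OF DERIV_\<phi> bounded_Hoelder_\<phi>']) simp

section \<open>Curvature of the unit circle\<close>

abbreviation (input) "unit_circle \<equiv> {x. N x = 1}"

section \<open>Independence of the curvature from the parametrization\<close>

lemma arclength_parametrization_level_set:
  assumes "arclength_parametrization \<gamma> L unit_circle"
  defines "\<gamma>1 \<equiv> \<lambda>s. vector_derivative \<gamma> (at s)"
  defines "\<gamma>2 \<equiv> \<lambda>s. vector_derivative \<gamma>1 (at s)"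
  shows "N (\<gamma> s) = 1" "norm (\<gamma>1 s) = 1" "D1 (\<gamma> s) (\<gamma>1 s) = 0"
    "D1 (\<gamma> s) (\<gamma>2 s) + D2 (\<gamma> s) (\<gamma>1 s) (\<gamma>1 s) = 0" "\<gamma>1 s \<bullet> \<gamma>2 s = 0"
proof -
  have L: "L > 0" and C2: "Ck_on 2 \<gamma> UNIV" and per: "\<And>s. \<gamma> (s + L) = \<gamma> s"
    and im: "\<gamma> ` {0..<L} = unit_circle" and unit: "\<And>s. norm (\<gamma>1 s) = 1"
    using assms(1) unfolding arclength_parametrization_def \<gamma>1_def by auto
  have d1: "(\<gamma> has_vector_derivative \<gamma>1 s) (at s)"
    and d2: "(\<gamma>1 has_vector_derivative \<gamma>2 s) (at s)" for s
    using Ck_on_2_realD[OF C2] unfolding \<gamma>1_def \<gamma>2_def by auto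
  show N1: "N (\<gamma> s) = 1" for s
  proof -
    obtain y where "0 \<le> y" "y < L" "\<gamma> y = \<gamma> s" using periodic_range[of \<gamma> L s] per L by blast
    then have "\<gamma> s \<in> \<gamma> ` {0..<L}" by (metis atLeastLessThan_iff image_eqI)
    then show ?thesis using im by simp
  qed
  have nz: "\<gamma> s \<noteq> 0" for s using N1[of s] by auto
  show D1_0: "D1 (\<gamma> s) (\<gamma>1 s) = 0" for s
    using DERIV_N_curve[OF d1[of s] nz] unfolding N1 by (metis DERIV_const DERIV_unique)
  show "D1 (\<gamma> s) (\<gamma>2 s) + D2 (\<gamma> s) (\<gamma>1 s) (\<gamma>1 s) = 0"
    using DERIV_D1_curve[OF d1[of s] d2[of s] nz] unfolding D1_0 by (metis DERIV_const DERIV_unique)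
  show "norm (\<gamma>1 s) = 1" by (rule unit)
  have "((\<lambda>s. \<gamma>1 s \<bullet> \<gamma>1 s) has_vector_derivative \<gamma>1 s \<bullet> \<gamma>2 s + \<gamma>2 s \<bullet> \<gamma>1 s) (at s)"
    by (rule bounded_bilinear.has_vector_derivative[OF bounded_bilinear_inner d2 d2])
  moreover have "(\<lambda>s. \<gamma>1 s \<bullet> \<gamma>1 s) = (\<lambda>s. 1)" using unit by (simp add: dot_square_norm)
  ultimately have "\<gamma>1 s \<bullet> \<gamma>2 s + \<gamma>2 s \<bullet> \<gamma>1 s = 0"
    by (metis has_vector_derivative_const vector_derivative_unique_at)
  then show "\<gamma>1 s \<bullet> \<gamma>2 s = 0" by (simp add: inner_commute)
qed

text \<open>Differentiating \<open>N (\<gamma> s) = 1\<close> twice fixes the component of the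
  second derivative along the gradient; differentiating the unit speed condition fixes the
  tangential one. Both depend on the tangent only up to sign.\<close>

lemma arclength_second_derivative_unique:
  assumes \<alpha>: "arclength_parametrization \<alpha> L unit_circle"
    and \<beta>: "arclength_parametrization \<beta> K unit_circle"
    and eq: "\<alpha> s = \<beta> t"
  shows "vector_derivative (\<lambda>u. vector_derivative \<alpha> (at u)) (at s)
    = vector_derivative (\<lambda>u. vector_derivative \<beta> (at u)) (at t)"
proof -
  define n where "n = (\<Sum>b\<in>Basis. partial_deriv b N (\<alpha> s) *\<^sub>R b)"
  have n: "D1 (\<alpha> s) h = n \<bullet> h" for h unfolding n_def by (rule D1_inner)
  define a1 a2 where "a1 = vector_derivative \<alpha> (at s)"
    and "a2 = vector_derivative (\<lambda>u. vector_derivative \<alpha> (at u)) (at s)"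
  define b1 b2 where "b1 = vector_derivative \<beta> (at t)"
    and "b2 = vector_derivative (\<lambda>u. vector_derivative \<beta> (at u)) (at t)"
  note defs = a1_def[symmetric] a2_def[symmetric] b1_def[symmetric] b2_def[symmetric]
  note a = arclength_parametrization_level_set[OF \<alpha>, of s, unfolded defs n]
  note b = arclength_parametrization_level_set[OF \<beta>, of t, folded eq, unfolded defs n]
  have "\<alpha> s \<noteq> 0" using a(1) by (metis N_zero zero_neq_one)
  \<comment> \<open>Euler's identity shows that the gradient \<open>n\<close> does not
    vanish.\<close>
  then have "n \<bullet> \<alpha> s = 1" using D1_self[of "\<alpha> s"] a(1) n by simp
  then have n0: "n \<noteq> 0" by auto
  \<comment> \<open>The two curves may run in opposite directions; \<open>D2\<close> is even in the
    tangent, so the sign disappears.\<close>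
  have "b1 = a1 \<or> b1 = - a1"
    using vec2_orthogonal_unit[OF n0 b(3) a(3) b(2) a(2)] .
  then have "D2 (\<alpha> s) b1 b1 = D2 (\<alpha> s) a1 a1" and ab: "a1 \<bullet> b2 = 0" using b(5) by auto
  then have "n \<bullet> (a2 - b2) = 0" using a(4) b(4) by (simp add: inner_diff_right)
  moreover have "a1 \<bullet> (a2 - b2) = 0" using a(5) ab by (simp add: inner_diff_right)
  ultimately have "a2 - b2 = 0" using vec2_orthogonal_basis_zero[OF n0 a(3) a(2)] by blast
  then show ?thesis by (simp add: a2_def b2_def)
qed

text \<open>Uniqueness of the second derivative makes the definite description in
  \<open>curvature\<close> meaningful, so any one arc-length parametrization computes it.\<close>

lemma curvature_arclength:
  assumes "arclength_parametrization \<gamma> L unit_circle"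
  shows "curvature unit_circle (\<gamma> s) = norm (vector_derivative (\<lambda>u. vector_derivative \<gamma> (at u)) (at s))"
  unfolding curvature_def
proof (rule the_equality)
  fix \<kappa>
  assume "\<exists>\<beta> K t. arclength_parametrization \<beta> K unit_circle \<and> \<beta> t = \<gamma> s \<and>
    \<kappa> = norm (vector_derivative (\<lambda>u. vector_derivative \<beta> (at u)) (at t))"
  then show "\<kappa> = norm (vector_derivative (\<lambda>u. vector_derivative \<gamma> (at u)) (at s))"
    using arclength_second_derivative_unique[OF _ assms] by metis
qed (use assms in blast)

lemma abs_\<phi> [simp]: "\<bar>\<phi> t\<bar> = \<phi> t"
  using \<phi>_pos[of t] by linarith

section \<open>The normal angle and its regularity\<close>

definition \<psi> where "\<psi> t = \<phi>' t / \<phi> t"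
definition \<psi>' where "\<psi>' t = (\<phi>'' t * \<phi> t - \<phi>' t * \<phi>' t) / (\<phi> t * \<phi> t)"

text \<open>The polar angle of the gradient of \<open>N\<close> at \<open>circle_vec t\<close>.\<close>
definition normal_angle where "normal_angle t = t + arctan (\<psi> t)"
definition normal_angle' where "normal_angle' t = 1 + \<psi>' t / (1 + (\<psi> t)\<^sup>2)"

lemma DERIV_\<psi>: "(\<psi> has_real_derivative \<psi>' t) (at t)"
  unfolding \<psi>_def[abs_def] \<psi>'_def by (rule DERIV_divide[OF DERIV_\<phi>' DERIV_\<phi>]) simp

lemma DERIV_normal_angle: "(normal_angle has_real_derivative normal_angle' t) (at t)"
  unfolding normal_angle_def[abs_def] normal_angle'_def
  by (auto intro!: derivative_eq_intros DERIV_\<psi> simp: divide_inverse)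

lemma \<psi>_periodic [simp]: "\<psi> (t + 2 * pi) = \<psi> t" "\<psi>' (t + 2 * pi) = \<psi>' t"
  by (simp_all add: \<psi>_def \<psi>'_def)

lemma normal_angle_periodic: "normal_angle (t + 2 * pi) = normal_angle t + 2 * pi"
    "normal_angle' (t + 2 * pi) = normal_angle' t"
  by (simp_all add: normal_angle_def normal_angle'_def)

lemma \<phi>_lower_bound: obtains m where "m > 0" "\<And>t. m \<le> \<phi> t"
proof -
  obtain a b where "\<And>t. \<phi> a \<le> \<phi> t" "\<And>t. \<phi> t \<le> \<phi> b"
    using periodic_continuous_bounds[of \<phi> "2 * pi"] DERIV_isCont[OF DERIV_\<phi>] by auto
  then show thesis using that[of "\<phi> a"] by simp
qed

lemma bounded_Hoelder_\<psi>: "bounded_Hoelder \<delta> \<psi>" "bounded_Hoelder \<delta> \<psi>'"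
proof -
  obtain m where m: "m > 0" "\<And>t. m \<le> \<phi> t" using \<phi>_lower_bound by blast
  have m2: "m * m > 0" "\<And>t. m * m \<le> \<phi> t * \<phi> t"
    using m by (auto intro!: mult_mono simp: less_imp_le)
  show "bounded_Hoelder \<delta> \<psi>"
    unfolding \<psi>_def[abs_def]
    by (rule bounded_Hoelder_divide[OF _ _ m]) (rule bounded_Hoelder_\<phi> bounded_Hoelder_\<phi>')+
  show "bounded_Hoelder \<delta> \<psi>'"
    unfolding \<psi>'_def[abs_def]
    by (rule bounded_Hoelder_divide[OF _ _ m2])
       (intro bounded_Hoelder_diff bounded_Hoelder_mult bounded_Hoelder_\<phi> bounded_Hoelder_\<phi>' bounded_Hoelder_\<phi>'')+
qed

lemma bounded_Hoelder_normal_angle': "bounded_Hoelder \<delta> normal_angle'"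
  unfolding normal_angle'_def[abs_def]
  by (intro bounded_Hoelder_add bounded_Hoelder_const bounded_Hoelder_divide[of _ _ _ 1]
      bounded_Hoelder_power bounded_Hoelder_\<psi>) auto

text \<open>The gradient at \<open>circle_vec t\<close> is \<open>\<phi> t\<close> times
  \<open>circle_vec t + \<psi> t *\<^sub>R rot90 (circle_vec t)\<close>. Its quarter turn,
  normalised, is the unit tangent of the unit circle of \<open>N\<close>.\<close>

lemma circle_vec_normal_angle:
  "rot90 (circle_vec (normal_angle t)) = (1 / sqrt (1 + (\<psi> t)\<^sup>2)) *\<^sub>R (rot90 (circle_vec t) - \<psi> t *\<^sub>R circle_vec t)"
  by (simp add: vec2_eq_iff normal_angle_def cos_add sin_add cos_arctan sin_arctan)
     (simp add: field_simps)

text \<open>The polar curve \<open>c t = circle_vec t / \<phi> t\<close> is reparametrized by its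
  arc length. Its unit tangent is the quarter turn of the normal, so the second derivative is
  proportional to \<open>normal_angle'\<close>.\<close>

lemma arclength_parametrization_exists:
  obtains \<gamma> L where "arclength_parametrization \<gamma> L unit_circle"
    "\<And>t. normal_angle' t = 0 \<Longrightarrow> \<exists>s. vector_derivative (\<lambda>u. vector_derivative \<gamma> (at u)) (at s) = 0"
proof -
  \<comment> \<open>The Euclidean speed of the curve \<open>c\<close> defined below.\<close>
  define f where "f t = sqrt (1 + (\<psi> t)\<^sup>2) / \<phi> t" for t
  have f_pos: "f t > 0" for t by (simp add: f_def)
  have cont_\<psi>: "isCont \<psi> t" and cont_\<phi>: "isCont \<phi> t" for t
    using DERIV_isCont[OF DERIV_\<psi>] DERIV_isCont[OF DERIV_\<phi>] by auto
  have cont_f: "isCont f t" for t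
    unfolding f_def[abs_def] by (intro continuous_intros cont_\<psi> cont_\<phi>) simp
  obtain l where l: "\<And>t. (l has_real_derivative f t) (at t)"
    using continuous_antiderivative[of f] cont_f by blast
  \<comment> \<open>The length of one turn; \<open>l\<close> is the arc-length function up to an
    additive constant.\<close>
  define L where "L = l (2 * pi) - l 0"
  have per: "l (t + 2 * pi) = l t + L" for t
  proof -
    have "((\<lambda>t. l (t + 2 * pi) - l t) has_real_derivative 0) (at t)" for t
    proof -
      have "((\<lambda>t. l (t + 2 * pi)) has_real_derivative f (t + 2 * pi)) (at t)"
        using DERIV_shift[of l "f (t + 2 * pi)" t "2 * pi"] l by simp
      from DERIV_diff[OF this l[of t]] show ?thesis by (simp add: f_def)
    qed
    then have "l (t + 2 * pi) - l t = l (0 + 2 * pi) - l 0" using DERIV_isconst_all by blast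
    then show ?thesis by (simp add: L_def)
  qed
  obtain \<sigma> where \<sigma>: "\<And>t. \<sigma> (l t) = t" "\<And>s. l (\<sigma> s) = s" "strict_mono l" "strict_mono \<sigma>" "L > 0"
    "\<And>s. (\<sigma> has_real_derivative 1 / f (\<sigma> s)) (at s)" "\<And>s. \<sigma> (s + L) = \<sigma> s + 2 * pi"
    using periodic_diffeomorphism[of l f "2 * pi" L] l f_pos per by (metis pi_gt_zero mult_pos_pos zero_less_numeral)
  define c where "c t = (1 / \<phi> t) *\<^sub>R circle_vec t" for t
  have c_deriv: "(c has_vector_derivative f t *\<^sub>R rot90 (circle_vec (normal_angle t))) (at t)" for t
  proof -
    have "((\<lambda>t. 1 / \<phi> t) has_real_derivative - \<psi> t / \<phi> t) (at t)"
      by (auto intro!: derivative_eq_intros DERIV_\<phi> simp: \<psi>_def)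
    then have "(c has_vector_derivative (1 / \<phi> t) *\<^sub>R rot90 (circle_vec t) + (- \<psi> t / \<phi> t) *\<^sub>R circle_vec t) (at t)"
      unfolding c_def[abs_def] by (rule has_vector_derivative_scaleR[OF _ has_vector_derivative_circle_vec])
    moreover have "f t *\<^sub>R rot90 (circle_vec (normal_angle t)) =
        (1 / \<phi> t) *\<^sub>R rot90 (circle_vec t) + (- \<psi> t / \<phi> t) *\<^sub>R circle_vec t"
      unfolding circle_vec_normal_angle f_def by (simp add: scaleR_diff_right)
    ultimately show ?thesis by simp
  qed
  have Nc: "N (c t) = 1" for t unfolding c_def N_scaleR by (simp add: \<phi>_def[symmetric])
  define \<gamma> where \<gamma>_eq: "\<gamma> = (\<lambda>s. c (\<sigma> s))"
  define \<gamma>1 where "\<gamma>1 s = rot90 (circle_vec (normal_angle (\<sigma> s)))" for s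
  define \<gamma>2 where "\<gamma>2 s = (normal_angle' (\<sigma> s) / f (\<sigma> s)) *\<^sub>R - circle_vec (normal_angle (\<sigma> s))" for s
  have \<sigma>v: "(\<sigma> has_vector_derivative 1 / f (\<sigma> s)) (at s)" for s
    using \<sigma>(6) by (simp add: has_real_derivative_iff_has_vector_derivative)
  have d1: "(\<gamma> has_vector_derivative \<gamma>1 s) (at s)" for s
  proof -
    have "(\<gamma> has_vector_derivative (1 / f (\<sigma> s)) *\<^sub>R f (\<sigma> s) *\<^sub>R \<gamma>1 s) (at s)"
      unfolding \<gamma>_eq \<gamma>1_def using vector_diff_chain_at[OF \<sigma>v c_deriv] by (simp add: o_def)
    then show ?thesis using f_pos[of "\<sigma> s"] by simp
  qed
  have d2: "(\<gamma>1 has_vector_derivative \<gamma>2 s) (at s)" for s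
  proof -
    have "((\<lambda>s. normal_angle (\<sigma> s)) has_vector_derivative normal_angle' (\<sigma> s) / f (\<sigma> s)) (at s)"
      using DERIV_chain2[OF DERIV_normal_angle \<sigma>(6)] by (simp add: has_real_derivative_iff_has_vector_derivative)
    from vector_diff_chain_at[OF this has_vector_derivative_rot90_circle_vec]
    show ?thesis unfolding \<gamma>1_def[abs_def] \<gamma>2_def by (simp add: o_def)
  qed
  have cont_2: "continuous_on UNIV \<gamma>2"
  proof -
    have 1: "isCont \<sigma> s" for s using DERIV_isCont[OF \<sigma>(6)] .
    have 2: "isCont (\<lambda>s. normal_angle' (\<sigma> s)) s" "isCont (\<lambda>s. f (\<sigma> s)) s"
        "isCont (\<lambda>s. circle_vec (normal_angle (\<sigma> s))) s" for s
      using isCont_o2[OF 1 bounded_Hoelder_imp_continuous[OF bounded_Hoelder_normal_angle' \<delta>_pos]]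
        isCont_o2[OF 1 cont_f]
        isCont_o2[OF isCont_o2[OF 1 DERIV_isCont[OF DERIV_normal_angle]]
          has_vector_derivative_continuous[OF has_vector_derivative_circle_vec]] by auto
    show ?thesis
      unfolding \<gamma>2_def[abs_def]
      by (intro continuous_at_imp_continuous_on ballI continuous_intros 2) (use f_pos in \<open>metis less_irrefl\<close>)
  qed
  have vd: "vector_derivative \<gamma> (at s) = \<gamma>1 s" "vector_derivative \<gamma>1 (at s) = \<gamma>2 s" for s
    using d1 d2 vector_derivative_at by blast+
  have inj: "inj_on \<gamma> {0..<L}" and image: "\<gamma> ` {0..<L} = unit_circle"
  proof -
    have c_eq: "circle_vec a = circle_vec b" if "c a = c b" for a b
    proof -
      have "norm (c a) = 1 / \<phi> a" "norm (c b) = 1 / \<phi> b" by (simp_all add: c_def)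
      with that have "\<phi> a = \<phi> b" by simp
      with that show ?thesis by (simp add: c_def)
    qed
    show "inj_on \<gamma> {0..<L}"
    proof (rule inj_onI)
      fix x y assume xy: "x \<in> {0..<L}" "y \<in> {0..<L}" "\<gamma> x = \<gamma> y"
      \<comment> \<open>One period of \<open>\<sigma>\<close> sweeps exactly one turn but starts at
        \<open>\<sigma> 0\<close>, which may differ from 0 because \<open>l\<close> is fixed only up
        to a constant. Angles are therefore shifted before injectivity is applied.\<close>
      have *: "0 \<le> \<sigma> z - \<sigma> 0" "\<sigma> z - \<sigma> 0 < 2 * pi" if "z \<in> {0..<L}" for z
        using that \<sigma>(7)[of 0] strict_mono_less_eq[OF \<sigma>(4), of 0 z] strict_mono_less[OF \<sigma>(4), of z L] by auto
      have "circle_vec (\<sigma> x) = circle_vec (\<sigma> y)" using xy(3) c_eq unfolding \<gamma>_eq by blast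
      then have "circle_vec (\<sigma> x - \<sigma> 0) = circle_vec (\<sigma> y - \<sigma> 0)"
        by (simp add: vec2_eq_iff cos_diff sin_diff)
      then have "\<sigma> x - \<sigma> 0 = \<sigma> y - \<sigma> 0" using circle_vec_inj * xy by blast
      then show "x = y" using strict_mono_eq[OF \<sigma>(4)] by simp
    qed
    show "\<gamma> ` {0..<L} = unit_circle"
    proof (intro equalityI subsetI)
      fix x assume "x \<in> unit_circle"
      then have N1: "N x = 1" by simp
      then have "x \<noteq> 0" by auto
      then obtain \<theta> where \<theta>: "x = norm x *\<^sub>R circle_vec \<theta>" using vec2_polar by metis
      have "norm x * \<phi> \<theta> = 1" using N1 N_scaleR[of "norm x" "circle_vec \<theta>"] \<theta> by (simp add: \<phi>_def)
      then have "norm x = 1 / \<phi> \<theta>" by (simp add: eq_divide_eq)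
      then have "x = c \<theta>" using \<theta> by (simp add: c_def)
      then have x: "x = \<gamma> (l \<theta>)" by (simp add: \<gamma>_eq \<sigma>(1))
      have "\<gamma> (s + L) = \<gamma> s" for s unfolding \<gamma>_eq \<sigma>(7) by (simp add: c_def)
      then obtain y where "0 \<le> y" "y < L" "\<gamma> y = \<gamma> (l \<theta>)"
        using periodic_range[of \<gamma> L "l \<theta>"] \<sigma>(5) by blast
      then show "x \<in> \<gamma> ` {0..<L}" using x by (metis atLeastLessThan_iff image_eqI)
    qed (use Nc \<gamma>_eq in auto)
  qed
  have "arclength_parametrization \<gamma> L unit_circle"
    unfolding arclength_parametrization_def vd
    using \<sigma>(5) Ck_on_2_realI[OF d1 d2 cont_2] inj image
    by (auto simp: \<gamma>1_def \<gamma>_eq \<sigma>(7) c_def)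
  moreover have "\<exists>s. vector_derivative (\<lambda>u. vector_derivative \<gamma> (at u)) (at s) = 0" if "normal_angle' t = 0" for t
    unfolding vd by (intro exI[of _ "l t"]) (simp add: \<gamma>2_def \<sigma>(1) that)
  ultimately show thesis using that by blast
qed

section \<open>Positive curvature makes the normal angle increasing\<close>

lemma normal_angle'_nonzero:
  assumes "\<forall>p\<in>frontier (unit_ball_of N). curvature (frontier (unit_ball_of N)) p > 0"
  shows "normal_angle' t \<noteq> 0"
proof
  assume 0: "normal_angle' t = 0"
  obtain \<gamma> L where \<gamma>: "arclength_parametrization \<gamma> L unit_circle"
    "\<And>t. normal_angle' t = 0 \<Longrightarrow> \<exists>s. vector_derivative (\<lambda>u. vector_derivative \<gamma> (at u)) (at s) = 0"
    using arclength_parametrization_exists by metis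
  obtain s where "vector_derivative (\<lambda>u. vector_derivative \<gamma> (at u)) (at s) = 0" using \<gamma>(2)[OF 0] by blast
  then have "curvature unit_circle (\<gamma> s) = 0" using curvature_arclength[OF \<gamma>(1)] by simp
  moreover have "\<gamma> s \<in> unit_circle" using arclength_parametrization_level_set(1)[OF \<gamma>(1)] by simp
  ultimately show False using assms unfolding frontier_unit_ball by fastforce
qed

lemma normal_angle'_pos_if_nonzero:
  assumes "\<And>t. normal_angle' t \<noteq> 0"
  shows "normal_angle' t > 0"
proof (rule ccontr)
  assume "\<not> normal_angle' t > 0"
  then have t: "normal_angle' t < 0" using assms[of t] by linarith
  \<comment> \<open>The normal angle gains \<open>2 * pi\<close> in one turn, so its derivative
    takes the value 1 somewhere; a negative value elsewhere would force a zero in between.\<close>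
  obtain z where "normal_angle (2 * pi) - normal_angle 0 = (2 * pi - 0) * normal_angle' z"
    using MVT2[of 0 "2 * pi" normal_angle normal_angle'] DERIV_normal_angle by auto
  then have z: "normal_angle' z = 1" using normal_angle_periodic(1)[of 0] by simp
  have cont: "isCont normal_angle' x" for x
    by (rule bounded_Hoelder_imp_continuous[OF bounded_Hoelder_normal_angle' \<delta>_pos])
  have "\<exists>x. normal_angle' x = 0"
  proof (cases "t \<le> z")
    case True
    then show ?thesis using IVT[of normal_angle' t 0 z] t z cont by auto
  next
    case False
    then show ?thesis using IVT2[of normal_angle' t 0 z] t z cont by auto
  qed
  with assms show False by blast
qed

end

section \<open>Closest-point projections\<close>

locale planar_C2_norm_curved = planar_C2_norm +
  assumes normal_angle'_pos: "normal_angle' t > 0"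
begin

section \<open>Inverting the normal angle\<close>

definition \<theta> where "\<theta> = inv normal_angle"

lemma normal_angle_\<theta>: "normal_angle (\<theta> t) = t"
  and strict_mono_normal_angle: "strict_mono normal_angle"
  and DERIV_\<theta>: "(\<theta> has_real_derivative 1 / normal_angle' (\<theta> t)) (at t)"
proof -
  obtain G where G: "\<And>x. G (normal_angle x) = x" "\<And>y. normal_angle (G y) = y" "strict_mono normal_angle"
    "strict_mono G" "2 * pi > 0" "\<And>y. (G has_real_derivative 1 / normal_angle' (G y)) (at y)"
    "\<And>y. G (y + 2 * pi) = G y + 2 * pi"
    by (rule periodic_diffeomorphism[of normal_angle normal_angle' "2 * pi" "2 * pi"])
       (use DERIV_normal_angle normal_angle'_pos normal_angle_periodic in auto)
  have "\<theta> = G" unfolding \<theta>_def using G(1,2) by (metis inv_equality)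
  then show "normal_angle (\<theta> t) = t" "strict_mono normal_angle"
    "(\<theta> has_real_derivative 1 / normal_angle' (\<theta> t)) (at t)" using G by auto
qed

text \<open>Since \<open>normal_angle (\<theta> t) = t\<close>, this is the tangent of
  \<open>\<theta> t - t\<close>, that is, the offset along
  \<open>{w. circle_vec t \<bullet> w = 1}\<close> of the point of polar angle
  \<open>\<theta> t\<close>.\<close>

definition g where "g t = - \<psi> (\<theta> t)"
definition g' where "g' t = - \<psi>' (\<theta> t) / normal_angle' (\<theta> t)"

lemma DERIV_g: "(g has_real_derivative g' t) (at t)"
  unfolding g_def[abs_def] g'_def using DERIV_minus[OF DERIV_chain2[OF DERIV_\<psi> DERIV_\<theta>]] by simp

lemma normal_angle'_bounds:
  obtains m M where "m > 0" "\<And>t. m \<le> normal_angle' t" "\<And>t. normal_angle' t \<le> M"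
proof -
  obtain a b where "\<And>t. normal_angle' a \<le> normal_angle' t" "\<And>t. normal_angle' t \<le> normal_angle' b"
    using periodic_continuous_bounds[of normal_angle' "2 * pi"] normal_angle_periodic(2)
      bounded_Hoelder_imp_continuous[OF bounded_Hoelder_normal_angle' \<delta>_pos] by auto
  then show thesis using that normal_angle'_pos by blast
qed

lemma bounded_Hoelder_compose_\<theta>:
  assumes "bounded_Hoelder \<delta> f"
  shows "bounded_Hoelder \<delta> (\<lambda>t. f (\<theta> t))"
proof -
  obtain m M where m: "m > 0" "\<And>t. m \<le> normal_angle' t" using normal_angle'_bounds by metis
  show ?thesis
  proof (rule bounded_Hoelder_compose_Lipschitz[OF assms \<delta>_pos DERIV_\<theta>])
    show "\<bar>1 / normal_angle' (\<theta> t)\<bar> \<le> 1 / m" for t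
      using m normal_angle'_pos[of "\<theta> t"] by (simp add: frac_le)
  qed
qed

lemma bounded_Hoelder_g: "bounded_Hoelder \<delta> g" "bounded_Hoelder \<delta> g'"
proof -
  obtain m M where m: "m > 0" "\<And>t. m \<le> normal_angle' t" using normal_angle'_bounds by metis
  show "bounded_Hoelder \<delta> g" "bounded_Hoelder \<delta> g'"
    unfolding g_def[abs_def] g'_def[abs_def]
    by (intro bounded_Hoelder_uminus bounded_Hoelder_divide[OF _ _ m]
        bounded_Hoelder_compose_\<theta> bounded_Hoelder_\<psi> bounded_Hoelder_normal_angle')+
qed

section \<open>Least norm on a line and the closest-point projection\<close>

definition nearest where "nearest t = circle_vec t + g t *\<^sub>R rot90 (circle_vec t)"

lemma N_tangent_line: "N (circle_vec t + s *\<^sub>R rot90 (circle_vec t)) = sqrt (1 + s\<^sup>2) * \<phi> (t + arctan s)"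
  unfolding circle_vec_plus_rot90 N_scaleR by (simp add: \<phi>_def[symmetric])

text \<open>The derivative of \<open>N\<close> along the line \<open>{w. circle_vec t \<bullet> w = 1}\<close> has the sign of
  \<open>normal_angle \<alpha> - t\<close>, where \<open>\<alpha>\<close> is the polar angle of \<open>w\<close>.\<close>
lemma N_nearest_less:
  assumes "s \<noteq> g t"
  shows "N (nearest t) < N (circle_vec t + s *\<^sub>R rot90 (circle_vec t))"
proof -
  define G where "G s = sqrt (1 + s\<^sup>2) * \<phi> (t + arctan s)" for s
  \<comment> \<open>The derivative of \<open>G\<close>, factored so that its sign is that of
    \<open>\<psi> (t + arctan s) + s\<close>.\<close>
  define G' where "G' s = \<phi> (t + arctan s) / sqrt (1 + s\<^sup>2) * (\<psi> (t + arctan s) + s)" for s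
  have DG: "(G has_real_derivative G' s) (at s)" for s
  proof -
    have "((\<lambda>s. t + arctan s) has_real_derivative 1 / (1 + s\<^sup>2)) (at s)"
      by (auto intro!: derivative_eq_intros simp: divide_inverse)
    then have A: "((\<lambda>s. \<phi> (t + arctan s)) has_real_derivative \<phi>' (t + arctan s) * (1 / (1 + s\<^sup>2))) (at s)"
      by (rule DERIV_chain2[where g = "\<lambda>s. t + arctan s", OF DERIV_\<phi>])
    have "s / sqrt (1 + s\<^sup>2) * \<phi> (t + arctan s) + \<phi>' (t + arctan s) * (1 / (1 + s\<^sup>2)) * sqrt (1 + s\<^sup>2) = G' s"
    proof -
      have "1 / (1 + s\<^sup>2) * sqrt (1 + s\<^sup>2) = 1 / sqrt (1 + s\<^sup>2)"
        by (simp add: frac_eq_eq less_imp_le)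
      moreover have "\<phi>' (t + arctan s) = \<phi> (t + arctan s) * \<psi> (t + arctan s)"
        by (simp add: \<psi>_def)
      ultimately show ?thesis
        unfolding G'_def by (simp only: mult.assoc) (simp add: algebra_simps add_divide_distrib)
    qed
    then show ?thesis
      using DERIV_mult[OF DERIV_sqrt_one_plus_square A] unfolding G_def[abs_def] by (simp only:)
  qed
  have \<theta>_eq: "t + arctan (g t) = \<theta> t"
    using normal_angle_\<theta>[of t] by (simp add: normal_angle_def g_def arctan_minus)
  \<comment> \<open>As \<open>arctan\<close> is increasing, the sign of this difference is the sign
    of \<open>\<psi> (t + arctan s) + s\<close>, hence of \<open>G' s\<close>.\<close>
  have sgn: "normal_angle (t + arctan s) - t = arctan (\<psi> (t + arctan s)) - arctan (- s)" for s
    by (simp add: normal_angle_def arctan_minus)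
  have pos: "G' s > 0" if "s > g t" for s
  proof -
    have "\<theta> t < t + arctan s" using that \<theta>_eq by (metis add_less_cancel_left arctan_less_iff)
    then have "t < normal_angle (t + arctan s)"
      using strict_mono_less[OF strict_mono_normal_angle] normal_angle_\<theta> by metis
    then have "arctan (- s) < arctan (\<psi> (t + arctan s))" using sgn[of s] by linarith
    then have "\<psi> (t + arctan s) + s > 0" unfolding arctan_less_iff by linarith
    then show ?thesis unfolding G'_def by (intro mult_pos_pos divide_pos_pos) auto
  qed
  have neg: "G' s < 0" if "s < g t" for s
  proof -
    have "t + arctan s < \<theta> t" using that \<theta>_eq by (metis add_less_cancel_left arctan_less_iff)
    then have "normal_angle (t + arctan s) < t"
      using strict_mono_less[OF strict_mono_normal_angle] normal_angle_\<theta> by metis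
    then have "arctan (\<psi> (t + arctan s)) < arctan (- s)" using sgn[of s] by linarith
    then have "\<psi> (t + arctan s) + s < 0" unfolding arctan_less_iff by linarith
    then show ?thesis unfolding G'_def by (intro mult_pos_neg divide_pos_pos) auto
  qed
  have cont: "continuous_on A G" for A
    using DERIV_isCont[OF DG] by (simp add: continuous_at_imp_continuous_on)
  \<comment> \<open>The derivative vanishes at the endpoint \<open>g t\<close>, so monotonicity is
    taken from its sign in the open interval.\<close>
  have "G (g t) < G s"
  proof (cases "g t < s")
    case True
    then show ?thesis
      by (rule DERIV_pos_imp_increasing_open) (use DG pos cont in auto)
  next
    case False
    with assms have "s < g t" by simp
    then show ?thesis
      by (rule DERIV_neg_imp_decreasing_open) (use DG neg cont in auto)
  qed
  then show ?thesis unfolding nearest_def N_tangent_line G_def .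
qed

text \<open>For \<open>c \<noteq> 0\<close> dividing by \<open>c\<close> leads back to the line at
  height 1, and the factor \<open>\<bar>c\<bar>\<close> leaves the comparison unchanged for either
  sign. At height 0 the minimum is at the origin.\<close>

lemma N_nearest_scaled:
  assumes "circle_vec t \<bullet> w = c" "w \<noteq> c *\<^sub>R nearest t"
  shows "N (c *\<^sub>R nearest t) < N w"
proof (cases "c = 0")
  case True
  with assms show ?thesis by (simp add: N_pos)
next
  case False
  define s where "s = (rot90 (circle_vec t) \<bullet> w) / c"
  have w: "w = c *\<^sub>R (circle_vec t + s *\<^sub>R rot90 (circle_vec t))"
    using circle_vec_frame[of w t] assms(1) False by (simp add: s_def scaleR_add_right)
  have "s \<noteq> g t" using assms(2) w nearest_def by auto
  then show ?thesis
    unfolding w N_scaleR using False by (intro mult_strict_left_mono N_nearest_less) auto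
qed

text \<open>As \<open>q\<close> runs through the normal line, \<open>x - q\<close> runs through the
  parallel line at height \<open>circle_vec t \<bullet> x\<close>, whose point of least
  \<open>N\<close> is known. Strictness of the minimum gives the uniqueness that \<open>THE\<close>
  requires.\<close>

lemma closest_proj_eq:
  "closest_proj N (circle_vec t) x = x - (circle_vec t \<bullet> x) *\<^sub>R nearest t"
  unfolding closest_proj_def
proof (rule the_equality)
  let ?p = "x - (circle_vec t \<bullet> x) *\<^sub>R nearest t"
  have "circle_vec t \<bullet> nearest t = 1" by (simp add: nearest_def inner_add_right)
  then have p: "?p \<in> normal_line (circle_vec t)" by (simp add: normal_line_def inner_diff_right)
  have *: "N (x - ?p) < N (x - q)" if "q \<in> normal_line (circle_vec t)" "q \<noteq> ?p" for q
  proof -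
    have "circle_vec t \<bullet> (x - q) = circle_vec t \<bullet> x" "x - q \<noteq> (circle_vec t \<bullet> x) *\<^sub>R nearest t"
      using that by (auto simp: normal_line_def inner_diff_right algebra_simps)
    from N_nearest_scaled[OF this] show ?thesis by simp
  qed
  show "?p \<in> normal_line (circle_vec t) \<and> (\<forall>q\<in>normal_line (circle_vec t). N (x - ?p) \<le> N (x - q))"
  proof (intro conjI ballI p)
    fix q assume "q \<in> normal_line (circle_vec t)"
    then show "N (x - ?p) \<le> N (x - q)" using *[of q] by (cases "q = ?p") simp_all
  qed
  show "p = ?p" if "p \<in> normal_line (circle_vec t) \<and> (\<forall>q\<in>normal_line (circle_vec t). N (x - p) \<le> N (x - q))" for p
  proof (rule ccontr)
    assume "p \<noteq> ?p"
    then have "N (x - ?p) < N (x - p)" using * conjunct1[OF that] by simp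
    moreover have "N (x - p) \<le> N (x - ?p)" by (rule bspec[OF conjunct2[OF that] p])
    ultimately show False by simp
  qed
qed

section \<open>The projections as inner products with a moving vector\<close>

definition u where "u t = rot90 (circle_vec t) - g t *\<^sub>R circle_vec t"
definition u' where "u' t = - (1 + g' t) *\<^sub>R circle_vec t - g t *\<^sub>R rot90 (circle_vec t)"

lemma proj_family_eq: "proj_family N t x = x \<bullet> u t"
  unfolding proj_family_def closest_proj_eq u_def nearest_def
  by (simp add: inner_diff_left inner_diff_right inner_add_left inner_commute[of x "circle_vec t"])

lemma has_vector_derivative_u: "(u has_vector_derivative u' t) (at t)"
proof -
  have "(u has_vector_derivative - circle_vec t - (g t *\<^sub>R rot90 (circle_vec t) + g' t *\<^sub>R circle_vec t)) (at t)"
    unfolding u_def[abs_def]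
    by (rule has_vector_derivative_diff[OF has_vector_derivative_rot90_circle_vec
          has_vector_derivative_scaleR[OF DERIV_g has_vector_derivative_circle_vec]])
  then show ?thesis by (simp add: u'_def algebra_simps)
qed

lemma DERIV_inner_u: "((\<lambda>t. x \<bullet> u t) has_real_derivative x \<bullet> u' t) (at t)"
  using bounded_linear.has_vector_derivative[OF bounded_linear_inner_right has_vector_derivative_u]
  by (simp add: has_real_derivative_iff_has_vector_derivative)

lemma bounded_Hoelder_vec2:
  fixes f :: "real \<Rightarrow> real ^ 2"
  assumes "\<And>b. b \<in> Basis \<Longrightarrow> bounded_Hoelder \<delta> (\<lambda>t. f t \<bullet> b)"
  shows "\<exists>B>0. \<forall>s t. norm (f t) \<le> B \<and> norm (f s - f t) \<le> B * \<bar>s - t\<bar> powr \<delta>"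
proof -
  have *: "bounded_Hoelder \<delta> (\<lambda>t. f t $ i)" for i
    using assms[of "axis i 1"] by (simp add: inner_axis)
  obtain A where A: "A > 0" "\<And>t. \<bar>f t $ 1\<bar> \<le> A" "\<And>s t. \<bar>f s $ 1 - f t $ 1\<bar> \<le> A * \<bar>s - t\<bar> powr \<delta>"
    using bounded_HoelderE[OF *[of 1]] by blast
  obtain C where C: "C > 0" "\<And>t. \<bar>f t $ 2\<bar> \<le> C" "\<And>s t. \<bar>f s $ 2 - f t $ 2\<bar> \<le> C * \<bar>s - t\<bar> powr \<delta>"
    using bounded_HoelderE[OF *[of 2]] by blast
  show ?thesis
  proof (intro exI[of _ "A + C"] conjI allI)
    show "A + C > 0" using A C by simp
    show "norm (f t) \<le> A + C" for t
      using norm_vec2_le[of "f t"] A(2)[of t] C(2)[of t] by linarith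
    show "norm (f s - f t) \<le> (A + C) * \<bar>s - t\<bar> powr \<delta>" for s t
      using norm_vec2_le[of "f s - f t"] A(3)[of s t] C(3)[of s t]
      unfolding distrib_right vector_minus_component by linarith
  qed
qed

lemma u_bounds:
  obtains B where "B > 0" "\<And>t. norm (u t) \<le> B" "\<And>t. norm (u' t) \<le> B"
    "\<And>s t. norm (u' s - u' t) \<le> B * \<bar>s - t\<bar> powr \<delta>"
proof -
  have "bounded_Hoelder \<delta> (\<lambda>t. u t \<bullet> b)" "bounded_Hoelder \<delta> (\<lambda>t. u' t \<bullet> b)" for b
    unfolding u_def u'_def inner_diff_left inner_scaleR_left
    by (intro bounded_Hoelder_diff bounded_Hoelder_mult bounded_Hoelder_uminus bounded_Hoelder_add
        bounded_Hoelder_const bounded_Hoelder_g bounded_Hoelder_circle_vec)+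
  note Hoelder = this
  obtain A where A: "A > 0" "\<And>t. norm (u t) \<le> A" "\<And>s t. norm (u s - u t) \<le> A * \<bar>s - t\<bar> powr \<delta>"
    using bounded_Hoelder_vec2[of u, OF Hoelder(1)] by blast
  obtain C where C: "C > 0" "\<And>t. norm (u' t) \<le> C" "\<And>s t. norm (u' s - u' t) \<le> C * \<bar>s - t\<bar> powr \<delta>"
    using bounded_Hoelder_vec2[of u', OF Hoelder(2)] by blast
  show thesis
  proof
    show "A + C > 0" using A C by simp
    show "norm (u t) \<le> A + C" "norm (u' t) \<le> A + C" for t
      using A(1) C(1) A(2)[of t] C(2)[of t] by linarith+
    show "norm (u' s - u' t) \<le> (A + C) * \<bar>s - t\<bar> powr \<delta>" for s t
      by (rule order_trans[OF C(3)]) (use A(1) in \<open>simp add: mult_right_mono\<close>)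
  qed
qed

text \<open>Uniform linear independence of \<open>u\<close> and \<open>u'\<close>, the quantitative
  form of transversality.\<close>

lemma det_u: obtains d where "d > 0" "\<And>t. d \<le> u t $ 1 * u' t $ 2 - u t $ 2 * u' t $ 1"
proof -
  obtain m M where M: "\<And>t. normal_angle' t \<le> M" using normal_angle'_bounds by metis
  have M0: "M > 0" using M[of 0] normal_angle'_pos[of 0] by linarith
  show thesis
  proof
    show "1 / M > 0" using M0 by simp
    fix t
    have "u t $ 1 * u' t $ 2 - u t $ 2 * u' t $ 1 = (cos t * cos t + sin t * sin t) * (1 + (g t)\<^sup>2 + g' t)"
      by (simp add: u_def u'_def algebra_simps power2_eq_square del: sin_cos_squared_add3)
    also have "\<dots> = 1 + (g t)\<^sup>2 + g' t" by (simp only: sin_cos_squared_add3 mult_1)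
    \<comment> \<open>Solving the definition of \<open>normal_angle'\<close> for
      \<open>\<psi>'\<close> makes the determinant collapse to
      \<open>(1 + g\<^sup>2) / normal_angle'\<close>, which is at least
      \<open>1 / M\<close>.\<close>
    also have "g' t = - ((1 + (g t)\<^sup>2) * (normal_angle' (\<theta> t) - 1)) / normal_angle' (\<theta> t)"
    proof -
      have "\<psi>' (\<theta> t) = (1 + (g t)\<^sup>2) * (normal_angle' (\<theta> t) - 1)"
        by (simp add: g_def normal_angle'_def)
      then show ?thesis by (simp only: g'_def)
    qed
    also have "1 + (g t)\<^sup>2 + \<dots> = (1 + (g t)\<^sup>2) / normal_angle' (\<theta> t)"
      using normal_angle'_pos[of "\<theta> t"] by (simp add: field_simps)
    also have "\<dots> \<ge> 1 / M"
      using M[of "\<theta> t"] normal_angle'_pos[of "\<theta> t"] by (intro frac_le) auto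
    finally show "1 / M \<le> u t $ 1 * u' t $ 2 - u t $ 2 * u' t $ 1" .
  qed
qed

text \<open>By homogeneity \<open>N x\<close> is \<open>norm x\<close> times a value of
  \<open>\<phi>\<close>, and \<open>\<phi>\<close> lies between its positive minimum and its
  maximum.\<close>

lemma N_norm_bounds:
  obtains m M where "m > 0" "M > 0" "\<And>x. m * norm x \<le> N x" "\<And>x. N x \<le> M * norm x"
proof -
  obtain a b where ab: "\<And>t. \<phi> a \<le> \<phi> t" "\<And>t. \<phi> t \<le> \<phi> b"
    using periodic_continuous_bounds[of \<phi> "2 * pi"] DERIV_isCont[OF DERIV_\<phi>] by auto
  have "\<phi> a * norm x \<le> N x \<and> N x \<le> \<phi> b * norm x" for x
  proof (cases "x = 0")
    case False
    then obtain \<alpha> where "x = norm x *\<^sub>R circle_vec \<alpha>" using vec2_polar by metis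
    then have "N x = \<phi> \<alpha> * norm x" by (metis N_scaleR \<phi>_def abs_norm_cancel mult.commute)
    then show ?thesis using ab by (simp add: mult_right_mono)
  qed simp
  then show thesis using that[of "\<phi> a" "\<phi> b"] by simp
qed

section \<open>Regularity and transversality of the family\<close>

lemma DERIV_proj_family: "((\<lambda>s. proj_family N s x) has_real_derivative x \<bullet> u' t) (at t)"
  unfolding proj_family_eq by (rule DERIV_inner_u)

lemma C1_Hoelder_proj_family: "C1_Hoelder_family \<delta> J (cball 0 r) (proj_family N)"
proof -
  obtain B where B: "B > 0" "\<And>t. norm (u t) \<le> B" "\<And>t. norm (u' t) \<le> B"
    "\<And>s t. norm (u' s - u' t) \<le> B * \<bar>s - t\<bar> powr \<delta>" using u_bounds by blast
  have deriv: "deriv (\<lambda>s. proj_family N s x) t = x \<bullet> u' t" for x t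
    using DERIV_proj_family by (rule DERIV_imp_deriv)
  \<comment> \<open>The summand 1 keeps the constant positive for every \<open>r\<close>. The bounds
    on \<open>u'\<close> hold on the whole line, so one constant serves all compact
    intervals.\<close>
  let ?C = "(\<bar>r\<bar> + 1) * B"
  have C: "\<bar>x \<bullet> w\<bar> \<le> (\<bar>r\<bar> + 1) * K" if "x \<in> cball 0 r" "norm w \<le> K" for x w :: "real ^ 2" and K
  proof -
    have "\<bar>x \<bullet> w\<bar> \<le> norm x * norm w" by (rule Cauchy_Schwarz_ineq2)
    also have "\<dots> \<le> (\<bar>r\<bar> + 1) * K" using that by (intro mult_mono) auto
    finally show ?thesis .
  qed
  show ?thesis
    unfolding C1_Hoelder_family_def deriv
  proof (intro conjI ballI allI impI exI[of _ ?C])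
    show "(\<lambda>s. proj_family N s x) differentiable (at t)" for x t
      using DERIV_proj_family by (metis real_differentiable_def)
    show "?C > 0" using B(1) by simp
    show "\<bar>x \<bullet> u' t\<bar> \<le> ?C" if "x \<in> cball 0 r" for x t using C[OF that B(3)] .
    show "\<bar>x \<bullet> u' s - x \<bullet> u' t\<bar> \<le> ?C * \<bar>s - t\<bar> powr \<delta>" if "x \<in> cball 0 r" for x s t
      using C[OF that B(4)[of s t]] by (simp add: inner_diff_right mult.assoc)
  qed
qed

lemma transversal_regular_proj_family:
  "\<exists>C>0. transversal_family C J X (\<lambda>x y. N (x - y)) (proj_family N) \<and>
         regular_family \<delta> C J X (\<lambda>x y. N (x - y)) (proj_family N)"
proof -
  obtain B where B: "B > 0" "\<And>t. norm (u t) \<le> B" "\<And>t. norm (u' t) \<le> B"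
    "\<And>s t. norm (u' s - u' t) \<le> B * \<bar>s - t\<bar> powr \<delta>" using u_bounds by blast
  obtain d where d: "d > 0" "\<And>t. d \<le> u t $ 1 * u' t $ 2 - u t $ 2 * u' t $ 1" using det_u by blast
  obtain m M where mM: "m > 0" "M > 0" "\<And>x. m * norm x \<le> N x" "\<And>x. N x \<le> M * norm x"
    using N_norm_bounds by metis
  let ?Q = "diff_quotient (proj_family N) (\<lambda>x y. N (x - y))"
  \<comment> \<open>By linearity the difference quotient is \<open>e x y \<bullet> u t\<close>, so
    all estimates reduce to vectors with \<open>N\<close> equal to 1.\<close>
  define e where "e x y = (x - y) /\<^sub>R N (x - y)" for x y
  have Q: "?Q x y = (\<lambda>t. e x y \<bullet> u t)" for x y
    by (auto simp: diff_quotient_def proj_family_eq e_def inner_diff_left divide_inverse)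
  have D: "(?Q x y has_real_derivative e x y \<bullet> u' t) (at t)" for x y t
    unfolding Q by (rule DERIV_inner_u)
  have deriv: "deriv (?Q x y) t = e x y \<bullet> u' t" for x y t using D by (rule DERIV_imp_deriv)
  have diff: "?Q x y differentiable (at t)" for x y t
    using D by (metis real_differentiable_def)
  have Ne: "N (e x y) = 1" if "x \<noteq> y" for x y
    using that N_pos[of "x - y"] by (simp add: e_def N_scaleR)
  have norm_e: "norm (e x y) \<le> 1 / m" if "x \<noteq> y" for x y
    using mM(3)[of "e x y"] Ne[OF that] mM(1) by (simp add: field_simps)
  have inner_e: "\<bar>e x y \<bullet> w\<bar> \<le> 1 / m * K" if "x \<noteq> y" "norm w \<le> K" for x y w K
  proof -
    have "\<bar>e x y \<bullet> w\<bar> \<le> norm (e x y) * norm w" by (rule Cauchy_Schwarz_ineq2)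
    also have "\<dots> \<le> 1 / m * K" using that norm_e mM(1) by (intro mult_mono) auto
    finally show ?thesis .
  qed
  \<comment> \<open>If both products with \<open>e x y\<close> were at most \<open>C\<close>,
    Cramer's rule would give \<open>d * norm (e x y) \<le> 4 * C * B\<close>, and
    \<open>1 = N (e x y) \<le> M * norm (e x y)\<close> would give
    \<open>d \<le> 4 * M * B * C\<close>. The factor 8 turns the right side into
    \<open>d / 2\<close>.\<close>
  define C where "C = d / (8 * M * B)"
  have C: "C > 0" using d mM B by (simp add: C_def)
  have trans: "C \<le> \<bar>e x y \<bullet> u' t\<bar>" if "x \<noteq> y" "\<bar>e x y \<bullet> u t\<bar> \<le> C" for x y t
  proof (rule ccontr)
    assume "\<not> C \<le> \<bar>e x y \<bullet> u' t\<bar>"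
    then have small: "\<bar>e x y \<bullet> u' t\<bar> \<le> C" by simp
    let ?e = "e x y" and ?D = "u t $ 1 * u' t $ 2 - u t $ 2 * u' t $ 1"
    have comp: "\<bar>u t $ i\<bar> \<le> B" "\<bar>u' t $ i\<bar> \<le> B" for i
      using B(2)[of t] B(3)[of t] component_le_norm_cart[of "u t" i] component_le_norm_cart[of "u' t" i]
      by linarith+
    \<comment> \<open>Cramer's rule for a coordinate \<open>z\<close> of \<open>e x y\<close>, with
      \<open>p\<close> and \<open>q\<close> taken from the entries of \<open>u'\<close> and
      \<open>u\<close> up to sign.\<close>
    have two: "d * \<bar>z\<bar> \<le> 2 * C * B"
      if "?D * z = (?e \<bullet> u t) * p - (?e \<bullet> u' t) * q" "\<bar>p\<bar> \<le> B" "\<bar>q\<bar> \<le> B" for z p q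
    proof -
      have "d * \<bar>z\<bar> \<le> ?D * \<bar>z\<bar>" using d(2)[of t] by (simp add: mult_right_mono)
      also have "\<dots> = \<bar>?D * z\<bar>" using d(1) d(2)[of t] by (simp add: abs_mult)
      also have "\<dots> \<le> \<bar>?e \<bullet> u t\<bar> * \<bar>p\<bar> + \<bar>?e \<bullet> u' t\<bar> * \<bar>q\<bar>"
        unfolding that(1) using abs_triangle_ineq4[of "(?e \<bullet> u t) * p" "(?e \<bullet> u' t) * q"]
        by (simp only: abs_mult)
      also have "\<dots> \<le> C * B + C * B"
        using small \<open>\<bar>?e \<bullet> u t\<bar> \<le> C\<close> that(2,3) C by (intro add_mono mult_mono) auto
      finally show ?thesis by (simp add: mult_ac)
    qed
    have "d * \<bar>?e $ 1\<bar> \<le> 2 * C * B"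
      by (rule two[OF _ comp(2)[of 2] comp(1)[of 2]]) (simp add: inner_vec2 algebra_simps)
    moreover have "d * \<bar>?e $ 2\<bar> \<le> 2 * C * B"
      by (rule two[of _ "- u' t $ 1" "- u t $ 1"])
         (use comp[of 1] in \<open>simp_all add: inner_vec2 algebra_simps\<close>)
    ultimately have "d * norm ?e \<le> 4 * C * B"
      using mult_left_mono[OF norm_vec2_le[of ?e], of d] d(1) by (simp add: distrib_left)
    then have "M * (d * norm ?e) \<le> M * (4 * C * B)" using mM(2) by (intro mult_left_mono) auto
    moreover have "d * 1 \<le> d * (M * norm ?e)"
      using mM(4)[of ?e] Ne[OF \<open>x \<noteq> y\<close>] d(1) by (intro mult_left_mono) auto
    ultimately have "d \<le> M * (4 * C * B)" by (simp add: mult.left_commute)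
    also have "\<dots> = d / 2" using mM(2) B(1) by (simp add: C_def)
    finally show False using d(1) by simp
  qed
  have "transversal_family C J X (\<lambda>x y. N (x - y)) (proj_family N)"
    unfolding transversal_family_def deriv using diff trans by (auto simp: Q)
  moreover have "regular_family \<delta> C J X (\<lambda>x y. N (x - y)) (proj_family N)"
    unfolding regular_family_def deriv
  \<comment> \<open>One constant serves both bounds: \<open>norm (e x y) \<le> 1 / m\<close> and the
    global bounds on \<open>u'\<close> are combined by Cauchy-Schwarz.\<close>
  proof (intro exI[of _ "1 / m * B"] conjI ballI impI)
    show "1 / m * B > 0" "1 / m * B > 0" using mM(1) B(1) by auto
    fix x y s t
    assume "x \<noteq> y \<and> \<bar>?Q x y s\<bar> + \<bar>?Q x y t\<bar> \<le> C"
    then have xy: "x \<noteq> y" by simp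
    show "\<bar>e x y \<bullet> u' s\<bar> \<le> 1 / m * B" using inner_e[OF xy B(3)] .
    show "\<bar>e x y \<bullet> u' s - e x y \<bullet> u' t\<bar> \<le> 1 / m * B * \<bar>s - t\<bar> powr \<delta>"
      using inner_e[OF xy B(4)[of s t]] by (simp add: inner_diff_right)
  qed (rule diff)+
  ultimately show ?thesis using C by blast
qed

end

theorem theorem4p2:
  fixes N :: "real ^ 2 \<Rightarrow> real" and \<delta> r :: real and J :: "real set" and \<Omega> :: "(real ^ 2) set"
  assumes "0 < \<delta>" and "\<delta> < 1"
    and "is_norm N"
    and "Ck_Hoelder_on 2 \<delta> N (- {0})"
    and "\<forall>p\<in>frontier (unit_ball_of N). curvature (frontier (unit_ball_of N)) p > 0"
    and "open J" and "is_interval J" and "J \<noteq> {}"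
    and "r > 0" and "\<Omega> = cball 0 r"
  shows "C1_Hoelder_family \<delta> J \<Omega> (proj_family N) \<and>
    (\<exists>C>0. transversal_family C J \<Omega> (\<lambda>x y. N (x - y)) (proj_family N) \<and>
           regular_family \<delta> C J \<Omega> (\<lambda>x y. N (x - y)) (proj_family N))"
proof -
  interpret planar_C2_norm N \<delta> by unfold_locales (use assms in auto)
  \<comment> \<open>The curvature hypothesis enters here, as positivity of
    \<open>normal_angle'\<close>.\<close>
  interpret planar_C2_norm_curved N \<delta>
    by unfold_locales (rule normal_angle'_pos_if_nonzero[OF normal_angle'_nonzero[OF assms(5)]])
  show ?thesis
    unfolding \<open>\<Omega> = cball 0 r\<close>
    by (rule conjI[OF C1_Hoelder_proj_family transversal_regular_proj_family])
qed

end
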